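(* Suppose that $\Gamma$ is a LEF group and that $\Gamma\curvearrowright_{\alpha}X$ is a LEF action on the set (respectively graph) $X$. Suppose that $\mathcal{L}$ is a set-theoretic (respectively graph-theoretic) halo of groups satisfying conditions (a) and (b) of the context. If $AL_f(X)$ is a LEF group, then so is $\mathcal{AL}(\Gamma,X)$. In particular, this holds if $L(Y)$ is finitely generated and residually finite for every finite subset (respectively finite induced subgraph) $Y\subseteq X$.
   Context: Haloes. A halo of groups over a set $X$ is a family of groups $\mathcal{L}_X=\{L(Y):Y\subseteq X\}$ such that (i) $L(Z)\leq L(Y)$ for all $Z\subseteq Y\subseteq X$; (ii) $L(\emptyset)$ is trivial and $L(X)=\langle L(Y):Y\subseteq X\text{ finite}\rangle$; (iii) $L(Y\cap Z)=L(Y)\cap L(Z)$ for all $Y,Z\subseteq X$. For a graph $X$, subsets of the vertex set are identified with induced subgraphs. A set-theoretic (respectively graph-theoretic) halo of groups is a covariant functor $\mathcal{L}$, written $X\mapsto L(X)$ and $\pi\mapsto\hat\pi$, from the category of sets with injective functions (respectively graphs with inclusions of induced subgraphs, i.e. injective vertex maps preserving adjacency and non-adjacency) to groups with monomorphisms, such that for every set (graph) $X$ the family $\{\hat\iota(L(Y)):Y\subseteq X\}$ ($\iota:Y\hookrightarrow X$ the inclusion) is a halo of groups over $X$; $L(Y)$ is identified with its image in $L(X)$. An action $\Gamma\curvearrowright_\alpha X$ (by graph automorphisms in the graph case) induces $\hat\alpha:\Gamma\to\operatorname{Aut}(L(X))$, $\hat\alpha(g)=\widehat{\alpha(g)}$.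 Automorphic enrichment. For $Y\subseteq X$ let $AL_f(X)=\{\beta\in\operatorname{Aut}(L(X)):\exists Y\subseteq X\text{ finite with }\beta(L(Y))=L(Y)\text{ and }\beta|_{L(X\setminus Y)}=\mathrm{id}\}$ and $AL_{f,X}(Y)=\{\beta\in AL_f(X):\beta(L(Y))=L(Y)\text{ and }\beta|_{L(X\setminus Y)}=\mathrm{id}\}$. $\Gamma$ acts on $AL_f(X)$ by $g\cdot\beta=\hat\alpha(g)\beta\hat\alpha(g)^{-1}$, and $\mathcal{AL}(\Gamma,X)=AL_f(X)\rtimes\Gamma$. Conditions on $\mathcal{L}$, required for every set (graph) $X$: (a) $L(Y\cup Z)=\langle L(Y)\cup L(Z)\rangle$ for all $Y,Z\subseteq X$; (b) if $Y\subseteq X$ is finite, then every $\beta\in\operatorname{Aut}(L(Y))$ extends to some $\tilde\beta\in AL_{f,X}(Y)$. A group $\Gamma$ is LEF (locally embeddable into finite groups) if for every finite $A\subseteq\Gamma$ there are a finite group $Q$ and an injective function $\phi:A\to Q$ with $\phi(gh)=\phi(g)\phi(h)$ whenever $g,h,gh\in A$. LEF actions. An action $\Gamma\curvearrowright_\alpha X$ on a set is a LEF action if for all finite $F\subseteq\Gamma$ and $Z\subseteq X$ there exist a finite group $Q$, a finite set $Y$, an action $Q\curvearrowright_\beta Y$ and functions $\rho:\Gamma\to Q$, $\pi:Z\to Y$, with $\pi$ injective, such that (i) for all $g,h\in F$ with $gh\in F$, $\rho(gh)=\rho(g)\rho(h)$; (ii) if $g\in F$ and $x\in Z$ are such that $\alpha(g)\cdot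 x\in Z$, then $\pi(\alpha(g)\cdot x)=\beta(\rho(g))\cdot\pi(x)$. For an action by automorphisms on a graph $X$ the definition is the same with $Z$ a finite induced subgraph of $X$, $Y$ a finite graph, $\beta$ an action by graph automorphisms, and $\pi$ an inclusion of an induced subgraph. *)

theory Defs
  imports "HOL-Algebra.Group_Action" "HOL-Algebra.Generated_Groups" "Graph_Theory.Pair_Digraph"
begin

section \<open>LEF groups, residual finiteness, finite generation\<close>

text \<open>Every finite group is isomorphic to one whose carrier is a set of natural numbers, so
  existentially quantified finite groups (and finite sets, finite graphs) range over \<^typ>\<open>nat\<close>.\<close>

definition LEF_group :: "('a, 'm) monoid_scheme \<Rightarrow> bool" where
  "LEF_group G \<longleftrightarrow> group G \<and>
     (\<forall>A. finite A \<and> A \<subseteq> carrier G \<longrightarrow>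
       (\<exists>(Q :: nat monoid) \<phi>. group Q \<and> finite (carrier Q) \<and>
          \<phi> \<in> A \<rightarrow> carrier Q \<and> inj_on \<phi> A \<and>
          (\<forall>g\<in>A. \<forall>h\<in>A. g \<otimes>\<^bsub>G\<^esub> h \<in> A \<longrightarrow> \<phi> (g \<otimes>\<^bsub>G\<^esub> h) = \<phi> g \<otimes>\<^bsub>Q\<^esub> \<phi> h)))"

definition residually_finite_group :: "('a, 'm) monoid_scheme \<Rightarrow> bool" where
  "residually_finite_group G \<longleftrightarrow> group G \<and>
     (\<forall>g\<in>carrier G. g \<noteq> \<one>\<^bsub>G\<^esub> \<longrightarrow>
       (\<exists>N. N \<lhd> G \<and> finite (carrier (G Mod N)) \<and> g \<notin> N))"

definition finitely_generated_group :: "('a, 'm) monoid_scheme \<Rightarrow> bool" where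
  "finitely_generated_group G \<longleftrightarrow> group G \<and>
     (\<exists>S. finite S \<and> S \<subseteq> carrier G \<and> generate G S = carrier G)"

text \<open>Here \<open>\<theta> g\<close> is the automorphism of \<open>N\<close> by which \<open>g\<close> acts.\<close>

definition semidirect ::
  "('b, 'n) monoid_scheme \<Rightarrow> ('a, 'm) monoid_scheme \<Rightarrow> ('a \<Rightarrow> 'b \<Rightarrow> 'b) \<Rightarrow> ('b \<times> 'a) monoid" where
  "semidirect N G \<theta> =
     \<lparr>carrier = carrier N \<times> carrier G,
      monoid.mult = (\<lambda>(n, g) (n', g'). (n \<otimes>\<^bsub>N\<^esub> \<theta> g n', g \<otimes>\<^bsub>G\<^esub> g')),
      monoid.one = (\<one>\<^bsub>N\<^esub>, \<one>\<^bsub>G\<^esub>)\<rparr>"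


section \<open>Graphs\<close>

text \<open>A (simple, possibly infinite) graph is a \<^const>\<open>pair_bidirected_digraph\<close>: the adjacency
  relation \<^const>\<open>parcs\<close> is symmetric, irreflexive, and contained in the square of the vertex set.\<close>

definition induced :: "'v pair_pre_digraph \<Rightarrow> 'v set \<Rightarrow> 'v pair_pre_digraph" where
  "induced X Y = \<lparr>pverts = Y, parcs = parcs X \<inter> (Y \<times> Y)\<rparr>"

definition graph_embedding ::
  "'v pair_pre_digraph \<Rightarrow> 'w pair_pre_digraph \<Rightarrow> ('v \<Rightarrow> 'w) \<Rightarrow> bool" where
  "graph_embedding X Y f \<longleftrightarrow> f \<in> pverts X \<rightarrow> pverts Y \<and> inj_on f (pverts X) \<and>
     (\<forall>u\<in>pverts X. \<forall>v\<in>pverts X. (u, v) \<in> parcs X \<longleftrightarrow> (f u, f v) \<in> parcs Y)"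

definition set_embedding :: "'v set \<Rightarrow> 'w set \<Rightarrow> ('v \<Rightarrow> 'w) \<Rightarrow> bool" where
  "set_embedding X Y f \<longleftrightarrow> f \<in> X \<rightarrow> Y \<and> inj_on f X"

text \<open>\<^const>\<open>group_action\<close> makes each \<open>\<alpha> g\<close> a bijection of the vertex set, so an \<open>\<alpha> g\<close> that is a
  graph embedding is a graph automorphism.\<close>

definition graph_action ::
  "('a, 'm) monoid_scheme \<Rightarrow> 'v pair_pre_digraph \<Rightarrow> ('a \<Rightarrow> 'v \<Rightarrow> 'v) \<Rightarrow> bool" where
  "graph_action G X \<alpha> \<longleftrightarrow> pair_bidirected_digraph X \<and> group_action G (pverts X) \<alpha> \<and>
     (\<forall>g\<in>carrier G. graph_embedding X X (\<alpha> g))"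


section \<open>LEF actions\<close>

definition LEF_action ::
  "('a, 'm) monoid_scheme \<Rightarrow> 'v set \<Rightarrow> ('a \<Rightarrow> 'v \<Rightarrow> 'v) \<Rightarrow> bool" where
  "LEF_action G X \<alpha> \<longleftrightarrow> group_action G X \<alpha> \<and>
     (\<forall>F Z. finite F \<and> F \<subseteq> carrier G \<and> finite Z \<and> Z \<subseteq> X \<longrightarrow>
       (\<exists>(Q :: nat monoid) (Y :: nat set) \<beta> \<rho> \<pi>.
          group Q \<and> finite (carrier Q) \<and> finite Y \<and> group_action Q Y \<beta> \<and>
          \<rho> \<in> carrier G \<rightarrow> carrier Q \<and> set_embedding Z Y \<pi> \<and>
          (\<forall>g\<in>F. \<forall>h\<in>F. g \<otimes>\<^bsub>G\<^esub> h \<in> F \<longrightarrow> \<rho> (g \<otimes>\<^bsub>G\<^esub> h) = \<rho> g \<otimes>\<^bsub>Q\<^esub> \<rho> h) \<and>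
          (\<forall>g\<in>F. \<forall>x\<in>Z. \<alpha> g x \<in> Z \<longrightarrow> \<pi> (\<alpha> g x) = \<beta> (\<rho> g) (\<pi> x))))"

definition LEF_graph_action ::
  "('a, 'm) monoid_scheme \<Rightarrow> 'v pair_pre_digraph \<Rightarrow> ('a \<Rightarrow> 'v \<Rightarrow> 'v) \<Rightarrow> bool" where
  "LEF_graph_action G X \<alpha> \<longleftrightarrow> graph_action G X \<alpha> \<and>
     (\<forall>F Z. finite F \<and> F \<subseteq> carrier G \<and> finite Z \<and> Z \<subseteq> pverts X \<longrightarrow>
       (\<exists>(Q :: nat monoid) (Y :: nat pair_pre_digraph) \<beta> \<rho> \<pi>.
          group Q \<and> finite (carrier Q) \<and> finite (pverts Y) \<and> graph_action Q Y \<beta> \<and>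
          \<rho> \<in> carrier G \<rightarrow> carrier Q \<and> graph_embedding (induced X Z) Y \<pi> \<and>
          (\<forall>g\<in>F. \<forall>h\<in>F. g \<otimes>\<^bsub>G\<^esub> h \<in> F \<longrightarrow> \<rho> (g \<otimes>\<^bsub>G\<^esub> h) = \<rho> g \<otimes>\<^bsub>Q\<^esub> \<rho> h) \<and>
          (\<forall>g\<in>F. \<forall>x\<in>Z. \<alpha> g x \<in> Z \<longrightarrow> \<pi> (\<alpha> g x) = \<beta> (\<rho> g) (\<pi> x))))"


section \<open>Haloes of groups\<close>

text \<open>A family over \<open>X\<close> is a function \<open>H\<close> giving the subgroups \<open>H Y\<close>, for \<open>Y \<subseteq> X\<close>, of the group
  \<open>G\<close>, which is the member at \<open>X\<close> itself.\<close>

definition halo :: "'v set \<Rightarrow> ('g, 'n) monoid_scheme \<Rightarrow> ('v set \<Rightarrow> 'g set) \<Rightarrow> bool" where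
  "halo X G H \<longleftrightarrow>
     group G \<and> H X = carrier G \<and>
     (\<forall>Y Z. Y \<subseteq> X \<and> Z \<subseteq> Y \<longrightarrow> subgroup (H Z) (G\<lparr>carrier := H Y\<rparr>)) \<and>
     H {} = {\<one>\<^bsub>G\<^esub>} \<and>
     carrier G = generate G (\<Union>{H Y | Y. Y \<subseteq> X \<and> finite Y}) \<and>
     (\<forall>Y Z. Y \<subseteq> X \<and> Z \<subseteq> X \<longrightarrow> H (Y \<inter> Z) = H Y \<inter> H Z)"

text \<open>A functor from a category of sets with structure to groups with monomorphisms. Objects are
  the \<open>X\<close> with \<open>Obj X\<close>, with underlying set \<open>pts X\<close>; morphisms \<open>X \<rightarrow> Y\<close> are the maps \<open>f\<close> with
  \<open>Mor X Y f\<close>, where maps agreeing on \<open>pts X\<close> represent the same morphism; \<open>hat X Y f\<close> is the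
  homomorphism induced by \<open>f\<close>, of which only the values on \<open>carrier (L X)\<close> matter.\<close>

definition mono_functor ::
  "('o \<Rightarrow> bool) \<Rightarrow> ('o \<Rightarrow> 'v set) \<Rightarrow> ('o \<Rightarrow> 'o \<Rightarrow> ('v \<Rightarrow> 'v) \<Rightarrow> bool) \<Rightarrow>
   ('o \<Rightarrow> 'g monoid) \<Rightarrow> ('o \<Rightarrow> 'o \<Rightarrow> ('v \<Rightarrow> 'v) \<Rightarrow> 'g \<Rightarrow> 'g) \<Rightarrow> bool" where
  "mono_functor Obj pts Mor L hat \<longleftrightarrow>
     (\<forall>X. Obj X \<longrightarrow> group (L X)) \<and>
     (\<forall>X Y f. Obj X \<and> Obj Y \<and> Mor X Y f \<longrightarrow> hat X Y f \<in> mon (L X) (L Y)) \<and>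
     (\<forall>X Y f f'. Obj X \<and> Obj Y \<and> Mor X Y f \<and> Mor X Y f' \<and> (\<forall>x\<in>pts X. f x = f' x) \<longrightarrow>
        (\<forall>a\<in>carrier (L X). hat X Y f a = hat X Y f' a)) \<and>
     (\<forall>X. Obj X \<longrightarrow> (\<forall>a\<in>carrier (L X). hat X X id a = a)) \<and>
     (\<forall>X Y Z f f'. Obj X \<and> Obj Y \<and> Obj Z \<and> Mor X Y f \<and> Mor Y Z f' \<longrightarrow>
        (\<forall>a\<in>carrier (L X). hat X Z (f' \<circ> f) a = hat Y Z f' (hat X Y f a)))"

text \<open>The image in \<open>L X\<close> of the group attached to a subset \<open>Y\<close> of \<open>X\<close>; the identity map represents
  the inclusion of \<open>Y\<close> in \<open>X\<close>.\<close>

definition set_family ::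
  "('v set \<Rightarrow> 'g monoid) \<Rightarrow> ('v set \<Rightarrow> 'v set \<Rightarrow> ('v \<Rightarrow> 'v) \<Rightarrow> 'g \<Rightarrow> 'g) \<Rightarrow>
   'v set \<Rightarrow> 'v set \<Rightarrow> 'g set" where
  "set_family L hat X Y = hat Y X id ` carrier (L Y)"

definition graph_family ::
  "('v pair_pre_digraph \<Rightarrow> 'g monoid) \<Rightarrow>
   ('v pair_pre_digraph \<Rightarrow> 'v pair_pre_digraph \<Rightarrow> ('v \<Rightarrow> 'v) \<Rightarrow> 'g \<Rightarrow> 'g) \<Rightarrow>
   'v pair_pre_digraph \<Rightarrow> 'v set \<Rightarrow> 'g set" where
  "graph_family L hat X Y = hat (induced X Y) X id ` carrier (L (induced X Y))"

text \<open>The type \<open>'v\<close> plays the role of the universe: the functor lives on all sets of elements of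
  \<open>'v\<close> (all graphs with vertices in \<open>'v\<close>), with values in groups over \<open>'g\<close>. A functor on all
  sets (graphs) restricts to one of this kind, for any choice of \<open>'v\<close>.\<close>

definition set_halo ::
  "('v set \<Rightarrow> 'g monoid) \<Rightarrow> ('v set \<Rightarrow> 'v set \<Rightarrow> ('v \<Rightarrow> 'v) \<Rightarrow> 'g \<Rightarrow> 'g) \<Rightarrow> bool" where
  "set_halo L hat \<longleftrightarrow>
     mono_functor (\<lambda>_. True) (\<lambda>X. X) set_embedding L hat \<and>
     (\<forall>X. halo X (L X) (set_family L hat X))"

definition graph_halo ::
  "('v pair_pre_digraph \<Rightarrow> 'g monoid) \<Rightarrow>
   ('v pair_pre_digraph \<Rightarrow> 'v pair_pre_digraph \<Rightarrow> ('v \<Rightarrow> 'v) \<Rightarrow> 'g \<Rightarrow> 'g) \<Rightarrow> bool" where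
  "graph_halo L hat \<longleftrightarrow>
     mono_functor pair_bidirected_digraph pverts graph_embedding L hat \<and>
     (\<forall>X. pair_bidirected_digraph X \<longrightarrow> halo (pverts X) (L X) (graph_family L hat X))"


section \<open>Automorphic enrichments\<close>

text \<open>Below, \<open>X\<close> is the (vertex) set, \<open>G\<close> stands for \<open>L(X)\<close>, and \<open>H\<close> for the family \<open>Y \<mapsto> L(Y)\<close>.\<close>

definition AL_f :: "'v set \<Rightarrow> 'g monoid \<Rightarrow> ('v set \<Rightarrow> 'g set) \<Rightarrow> ('g \<Rightarrow> 'g) set" where
  "AL_f X G H = {\<beta> \<in> auto G.
     \<exists>Y. Y \<subseteq> X \<and> finite Y \<and> \<beta> ` H Y = H Y \<and> (\<forall>x \<in> H (X - Y). \<beta> x = x)}"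

definition AL_fX :: "'v set \<Rightarrow> 'g monoid \<Rightarrow> ('v set \<Rightarrow> 'g set) \<Rightarrow> 'v set \<Rightarrow> ('g \<Rightarrow> 'g) set" where
  "AL_fX X G H Y = {\<beta> \<in> AL_f X G H. \<beta> ` H Y = H Y \<and> (\<forall>x \<in> H (X - Y). \<beta> x = x)}"

definition AL_f_group :: "'v set \<Rightarrow> 'g monoid \<Rightarrow> ('v set \<Rightarrow> 'g set) \<Rightarrow> ('g \<Rightarrow> 'g) monoid" where
  "AL_f_group X G H = (AutoGroup G)\<lparr>carrier := AL_f X G H\<rparr>"

definition condition_a :: "'v set \<Rightarrow> 'g monoid \<Rightarrow> ('v set \<Rightarrow> 'g set) \<Rightarrow> bool" where
  "condition_a X G H \<longleftrightarrow>
     (\<forall>Y Z. Y \<subseteq> X \<and> Z \<subseteq> X \<longrightarrow> H (Y \<union> Z) = generate G (H Y \<union> H Z))"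

definition condition_b :: "'v set \<Rightarrow> 'g monoid \<Rightarrow> ('v set \<Rightarrow> 'g set) \<Rightarrow> bool" where
  "condition_b X G H \<longleftrightarrow>
     (\<forall>Y. Y \<subseteq> X \<and> finite Y \<longrightarrow>
       (\<forall>\<beta> \<in> auto (G\<lparr>carrier := H Y\<rparr>). \<exists>\<beta>' \<in> AL_fX X G H Y. \<forall>x \<in> H Y. \<beta>' x = \<beta> x))"

text \<open>The automorphism \<open>\<alpha>^(g)\<close> of \<open>L(X)\<close> induced by an action \<open>\<alpha>\<close>; the restriction makes it
  extensional, as \<^const>\<open>auto\<close> demands.\<close>

definition induced_auto ::
  "('o \<Rightarrow> 'g monoid) \<Rightarrow> ('o \<Rightarrow> 'o \<Rightarrow> ('v \<Rightarrow> 'v) \<Rightarrow> 'g \<Rightarrow> 'g) \<Rightarrow> 'o \<Rightarrow>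
   ('a \<Rightarrow> 'v \<Rightarrow> 'v) \<Rightarrow> 'a \<Rightarrow> 'g \<Rightarrow> 'g" where
  "induced_auto L hat X \<alpha> g = restrict (hat X X (\<alpha> g)) (carrier (L X))"

definition enrichment ::
  "'a monoid \<Rightarrow> 'v set \<Rightarrow> 'g monoid \<Rightarrow> ('v set \<Rightarrow> 'g set) \<Rightarrow> ('a \<Rightarrow> 'g \<Rightarrow> 'g) \<Rightarrow>
   (('g \<Rightarrow> 'g) \<times> 'a) monoid" where
  "enrichment \<Gamma> X G H a = semidirect (AL_f_group X G H) \<Gamma>
     (\<lambda>g \<beta>. a g \<otimes>\<^bsub>AutoGroup G\<^esub> \<beta> \<otimes>\<^bsub>AutoGroup G\<^esub> inv\<^bsub>AutoGroup G\<^esub> (a g))"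

definition set_AL_f_group ::
  "('v set \<Rightarrow> 'g monoid) \<Rightarrow> ('v set \<Rightarrow> 'v set \<Rightarrow> ('v \<Rightarrow> 'v) \<Rightarrow> 'g \<Rightarrow> 'g) \<Rightarrow>
   'v set \<Rightarrow> ('g \<Rightarrow> 'g) monoid" where
  "set_AL_f_group L hat X = AL_f_group X (L X) (set_family L hat X)"

definition graph_AL_f_group ::
  "('v pair_pre_digraph \<Rightarrow> 'g monoid) \<Rightarrow>
   ('v pair_pre_digraph \<Rightarrow> 'v pair_pre_digraph \<Rightarrow> ('v \<Rightarrow> 'v) \<Rightarrow> 'g \<Rightarrow> 'g) \<Rightarrow>
   'v pair_pre_digraph \<Rightarrow> ('g \<Rightarrow> 'g) monoid" where
  "graph_AL_f_group L hat X = AL_f_group (pverts X) (L X) (graph_family L hat X)"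

definition set_enrichment ::
  "('v set \<Rightarrow> 'g monoid) \<Rightarrow> ('v set \<Rightarrow> 'v set \<Rightarrow> ('v \<Rightarrow> 'v) \<Rightarrow> 'g \<Rightarrow> 'g) \<Rightarrow>
   'a monoid \<Rightarrow> 'v set \<Rightarrow> ('a \<Rightarrow> 'v \<Rightarrow> 'v) \<Rightarrow> (('g \<Rightarrow> 'g) \<times> 'a) monoid" where
  "set_enrichment L hat \<Gamma> X \<alpha> =
     enrichment \<Gamma> X (L X) (set_family L hat X) (induced_auto L hat X \<alpha>)"

definition graph_enrichment ::
  "('v pair_pre_digraph \<Rightarrow> 'g monoid) \<Rightarrow>
   ('v pair_pre_digraph \<Rightarrow> 'v pair_pre_digraph \<Rightarrow> ('v \<Rightarrow> 'v) \<Rightarrow> 'g \<Rightarrow> 'g) \<Rightarrow>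
   'a monoid \<Rightarrow> 'v pair_pre_digraph \<Rightarrow> ('a \<Rightarrow> 'v \<Rightarrow> 'v) \<Rightarrow> (('g \<Rightarrow> 'g) \<times> 'a) monoid" where
  "graph_enrichment L hat \<Gamma> X \<alpha> =
     enrichment \<Gamma> (pverts X) (L X) (graph_family L hat X) (induced_auto L hat X \<alpha>)"

definition set_halo_conditions ::
  "('v set \<Rightarrow> 'g monoid) \<Rightarrow> ('v set \<Rightarrow> 'v set \<Rightarrow> ('v \<Rightarrow> 'v) \<Rightarrow> 'g \<Rightarrow> 'g) \<Rightarrow> bool" where
  "set_halo_conditions L hat \<longleftrightarrow>
     (\<forall>X. condition_a X (L X) (set_family L hat X) \<and> condition_b X (L X) (set_family L hat X))"

definition graph_halo_conditions ::
  "('v pair_pre_digraph \<Rightarrow> 'g monoid) \<Rightarrow>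
   ('v pair_pre_digraph \<Rightarrow> 'v pair_pre_digraph \<Rightarrow> ('v \<Rightarrow> 'v) \<Rightarrow> 'g \<Rightarrow> 'g) \<Rightarrow> bool" where
  "graph_halo_conditions L hat \<longleftrightarrow>
     (\<forall>X. pair_bidirected_digraph X \<longrightarrow>
        condition_a (pverts X) (L X) (graph_family L hat X) \<and>
        condition_b (pverts X) (L X) (graph_family L hat X))"

end

theory Submission
  imports Defs "HOL-Algebra.Weak_Morphisms" "HOL-Library.Countable_Set" "HOL-Combinatorics.Permutations"
begin

text \<open>Condition (b) forces \<open>L\<close> to be blind to the edges of a graph: the transposition of two
  vertices is an automorphism of the graph they induce, so it extends to an element of \<open>AL\<^sub>f(X)\<close>.
  Hence every finitary permutation of \<open>X\<close> is realised in \<open>AL\<^sub>f(X)\<close>, permuting labelled copies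
  \<open>e x\<close> of one group \<open>L({x\<^sub>0})\<close>, and sets and graphs can be treated alike. A LEF action yields
  finitary permutations of \<open>X\<close> itself which imitate \<open>\<alpha>\<close> on given finite sets, hence elements
  \<open>t g \<in> AL\<^sub>f(X)\<close>, multiplicative where needed, that act by conjugation on finitely many
  elements of \<open>AL\<^sub>f(X)\<close> as \<open>g\<close> does. So \<open>(\<beta>, g) \<mapsto> (\<beta> t(g), g)\<close> locally embeds the
  enrichment into the direct product of \<open>AL\<^sub>f(X)\<close> and \<open>\<Gamma>\<close>. For the second claim, \<open>AL\<^sub>f(X)\<close>
  locally embeds into the groups \<open>Aut(L(Y))\<close> with \<open>Y\<close> finite, which are residually finite
  (Baumslag).\<close>

section \<open>LEF groups and separation by finite quotients\<close>

text \<open>The obstacle: only \<open>AL_f(X)\<close> is known to be LEF, while the finite set or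
  graph that a LEF action produces lies outside \<open>X\<close>, and nothing is known about the
  automorphisms of its group. The approximation is therefore carried back into \<open>X\<close>.
  Only the finite part of it that imitates \<open>X\<close> has a prescribed position; its other
  points go anywhere in \<open>X\<close>, where an infinite \<open>X\<close> has room, and a finite
  \<open>X\<close> is permuted by the action itself. In a graph this placement disregards adjacency,
  so the permutations it yields need not be automorphisms of the graph; functoriality cannot realise
  them, and the transpositions obtained from condition (b) do.

  Permutations suffice because halo axiom (ii) and condition (a) make each \<open>L(Y)\<close>
  generated by its one-point groups: an automorphism of \<open>L(X)\<close> is determined by its
  values on the labelled elements \<open>e x d\<close>.

  The local embedding keeps \<open>g\<close> as a second coordinate because \<open>t(g)\<close> may
  forget it: the map \<open>\<rho>\<close> of a LEF action need not be injective. This is where the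
  LEF property of \<Gamma> itself enters.\<close>

lemma hom_eq_on_generate:
  assumes "group G" "group K" "f \<in> hom G K" "f' \<in> hom G K" "S \<subseteq> carrier G"
    and "\<And>s. s \<in> S \<Longrightarrow> f s = f' s" and "x \<in> generate G S"
  shows "f x = f' x"
proof -
  interpret f: group_hom G K f using assms by (simp add: group_hom_def group_hom_axioms_def)
  interpret f': group_hom G K f' using assms by (simp add: group_hom_def group_hom_axioms_def)
  show ?thesis
    using assms(7)
  proof (induction rule: generate.induct)
    case (eng h1 h2)
    then have "h1 \<in> carrier G" "h2 \<in> carrier G"
      using f.G.generate_in_carrier[OF assms(5)] by auto
    with eng show ?case by simp
  qed (use assms(5,6) in auto)
qed

text \<open>The finite groups in \<open>LEF_group\<close> are carried by naturals, so products and
  permutation groups built over other types have to be relabelled.\<close>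

lemma finite_group_nat_copy:
  assumes "group Q" "finite (carrier Q)"
  obtains Q' :: "nat monoid" and h
  where "group Q'" "finite (carrier Q')" "h \<in> hom Q Q'" "inj_on h (carrier Q)"
proof -
  let ?h = "to_nat_on (carrier Q)"
  have inj: "inj_on ?h (carrier Q)"
    using assms(2) by (simp add: countable_finite inj_on_to_nat_on)
  show ?thesis
  proof (rule that[of "image_group ?h Q"])
    show "group (image_group ?h Q)"
      by (rule group.inj_imp_image_group_is_group[OF assms(1) inj])
    show "?h \<in> hom Q (image_group ?h Q)"
      using inj_imp_image_group_iso[OF inj] by (simp add: iso_def)
  qed (use assms inj in \<open>simp_all add: image_group_carrier\<close>)
qed

lemma LEF_groupE:
  assumes "LEF_group G" "finite A" "A \<subseteq> carrier G"
  obtains Q :: "nat monoid" and \<phi>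
  where "group Q" "finite (carrier Q)" "\<phi> \<in> A \<rightarrow> carrier Q" "inj_on \<phi> A"
    "\<forall>g\<in>A. \<forall>h\<in>A. g \<otimes>\<^bsub>G\<^esub> h \<in> A \<longrightarrow> \<phi> (g \<otimes>\<^bsub>G\<^esub> h) = \<phi> g \<otimes>\<^bsub>Q\<^esub> \<phi> h"
  using assms unfolding LEF_group_def by meson

text \<open>The LEF property is tested on one finite set at a time, so the target may vary with
  \<open>A\<close> and need only be LEF: a local embedding of it, taken on the image of
  \<open>A\<close>, is composed with \<open>\<phi>\<close>. All later proofs of the LEF property for
  large groups go through this relaxation.\<close>

lemma LEF_groupI:
  fixes G :: "('a, 'm) monoid_scheme"
  assumes "group G"
    and "\<And>A. finite A \<Longrightarrow> A \<subseteq> carrier G \<Longrightarrow>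
      \<exists>(K :: ('k, 'n) monoid_scheme) \<phi>. LEF_group K \<and> \<phi> \<in> A \<rightarrow> carrier K \<and> inj_on \<phi> A \<and>
          (\<forall>g\<in>A. \<forall>h\<in>A. g \<otimes>\<^bsub>G\<^esub> h \<in> A \<longrightarrow> \<phi> (g \<otimes>\<^bsub>G\<^esub> h) = \<phi> g \<otimes>\<^bsub>K\<^esub> \<phi> h)"
  shows "LEF_group G"
  unfolding LEF_group_def
proof (intro conjI allI impI)
  fix A assume "finite A \<and> A \<subseteq> carrier G"
  then have "finite A" "A \<subseteq> carrier G" by auto
  from assms(2)[OF this] obtain K :: "('k, 'n) monoid_scheme" and \<phi> where
    K: "LEF_group K" "\<phi> \<in> A \<rightarrow> carrier K" "inj_on \<phi> A"
      "\<And>g h. g \<in> A \<Longrightarrow> h \<in> A \<Longrightarrow> g \<otimes>\<^bsub>G\<^esub> h \<in> A \<Longrightarrow> \<phi> (g \<otimes>\<^bsub>G\<^esub> h) = \<phi> g \<otimes>\<^bsub>K\<^esub> \<phi> h"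
    by blast
  have im: "finite (\<phi> ` A)" "\<phi> ` A \<subseteq> carrier K"
    using \<open>finite A\<close> K(2) by auto
  obtain Q :: "nat monoid" and \<psi> where Q: "group Q" "finite (carrier Q)"
      "\<psi> \<in> \<phi> ` A \<rightarrow> carrier Q" "inj_on \<psi> (\<phi> ` A)"
      "\<forall>g\<in>\<phi> ` A. \<forall>h\<in>\<phi> ` A. g \<otimes>\<^bsub>K\<^esub> h \<in> \<phi> ` A \<longrightarrow> \<psi> (g \<otimes>\<^bsub>K\<^esub> h) = \<psi> g \<otimes>\<^bsub>Q\<^esub> \<psi> h"
    using LEF_groupE[OF K(1) im] .
  have "\<psi> \<circ> \<phi> \<in> A \<rightarrow> carrier Q" "inj_on (\<psi> \<circ> \<phi>) A"
    using Q(3,4) K(3) by (auto intro: comp_inj_on)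
  moreover have "(\<psi> \<circ> \<phi>) (g \<otimes>\<^bsub>G\<^esub> h) = (\<psi> \<circ> \<phi>) g \<otimes>\<^bsub>Q\<^esub> (\<psi> \<circ> \<phi>) h"
    if "g \<in> A" "h \<in> A" "g \<otimes>\<^bsub>G\<^esub> h \<in> A" for g h
  proof -
    have "\<phi> g \<otimes>\<^bsub>K\<^esub> \<phi> h \<in> \<phi> ` A" using K(4)[OF that] that by (metis imageI)
    then show ?thesis using K(4)[OF that] Q(5) that by simp
  qed
  ultimately show "\<exists>(Q :: nat monoid) \<phi>. group Q \<and> finite (carrier Q) \<and> \<phi> \<in> A \<rightarrow> carrier Q \<and>
      inj_on \<phi> A \<and> (\<forall>g\<in>A. \<forall>h\<in>A. g \<otimes>\<^bsub>G\<^esub> h \<in> A \<longrightarrow> \<phi> (g \<otimes>\<^bsub>G\<^esub> h) = \<phi> g \<otimes>\<^bsub>Q\<^esub> \<phi> h)"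
    using Q(1,2) by blast
qed (fact assms(1))

section \<open>Separation of elements by homomorphisms to finite groups\<close>

text \<open>For groups this is residual finiteness, with normal subgroups of finite index replaced
  by homomorphisms. In this form it pulls back along monomorphisms, and homomorphisms, unlike
  subgroups, are points on which automorphisms can act.\<close>

definition homs_to_finite_separate :: "('a, 'm) monoid_scheme \<Rightarrow> bool" where
  "homs_to_finite_separate G \<longleftrightarrow>
     (\<forall>g\<in>carrier G. g \<noteq> \<one>\<^bsub>G\<^esub> \<longrightarrow>
       (\<exists>(Q :: nat monoid) \<phi>. group Q \<and> finite (carrier Q) \<and> \<phi> \<in> hom G Q \<and> \<phi> g \<noteq> \<one>\<^bsub>Q\<^esub>))"

lemma homs_to_finite_separateI:
  fixes G :: "('a, 'm) monoid_scheme"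
  assumes "\<And>g. g \<in> carrier G \<Longrightarrow> g \<noteq> \<one>\<^bsub>G\<^esub> \<Longrightarrow>
    \<exists>(P :: ('p, 'n) monoid_scheme) f. group P \<and> finite (carrier P) \<and> f \<in> hom G P \<and> f g \<noteq> \<one>\<^bsub>P\<^esub>"
  shows "homs_to_finite_separate G"
  unfolding homs_to_finite_separate_def
proof (intro ballI impI)
  fix g assume g: "g \<in> carrier G" "g \<noteq> \<one>\<^bsub>G\<^esub>"
  then obtain P :: "('p, 'n) monoid_scheme" and f
    where P: "group P" "finite (carrier P)" "f \<in> hom G P" "f g \<noteq> \<one>\<^bsub>P\<^esub>"
    using assms by blast
  obtain Q :: "nat monoid" and h
    where Q: "group Q" "finite (carrier Q)" "h \<in> hom P Q" "inj_on h (carrier P)"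
    using finite_group_nat_copy[OF P(1,2)] .
  have "h (f g) \<noteq> h \<one>\<^bsub>P\<^esub>"
    using inj_onD[OF Q(4)] P(4) hom_in_carrier[OF P(3) g(1)] monoid.one_closed[OF group.is_monoid[OF P(1)]]
    by blast
  moreover have "h \<one>\<^bsub>P\<^esub> = \<one>\<^bsub>Q\<^esub>" using hom_one[OF Q(3) P(1) Q(1)] .
  moreover have "h \<circ> f \<in> hom G Q" by (rule Group.hom_compose[OF P(3) Q(3)])
  ultimately show "\<exists>(Q :: nat monoid) \<phi>. group Q \<and> finite (carrier Q) \<and> \<phi> \<in> hom G Q \<and> \<phi> g \<noteq> \<one>\<^bsub>Q\<^esub>"
    using Q(1,2) by (metis comp_apply)
qed

lemma homs_to_finite_separate_if_residually_finite:
  fixes G (structure)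
  assumes "residually_finite_group G"
  shows "homs_to_finite_separate G"
proof (rule homs_to_finite_separateI)
  fix g assume g: "g \<in> carrier G" "g \<noteq> \<one>\<^bsub>G\<^esub>"
  then obtain N where N: "N \<lhd> G" "finite (carrier (G Mod N))" "g \<notin> N"
    using assms by (auto simp: residually_finite_group_def)
  interpret N: normal N G by fact
  have "N #> g \<noteq> N" using N(3) g N.rcos_self[OF g(1) N.subgroup_axioms] by auto
  then show "\<exists>(P :: 'a set monoid) f. group P \<and> finite (carrier P) \<and> f \<in> hom G P \<and> f g \<noteq> \<one>\<^bsub>P\<^esub>"
    using N.factorgroup_is_group N(2) N.r_coset_hom_Mod N.is_group
    by (intro exI[of _ "G Mod N"] exI[of _ "\<lambda>a. N #> a"]) (simp add: FactGroup_def)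
qed

lemma homs_to_finite_separate_mon:
  assumes "group G" "group K" "f \<in> mon G K" "homs_to_finite_separate K"
  shows "homs_to_finite_separate G"
proof (rule homs_to_finite_separateI)
  fix g assume g: "g \<in> carrier G" "g \<noteq> \<one>\<^bsub>G\<^esub>"
  then have "f g \<in> carrier K" "f g \<noteq> \<one>\<^bsub>K\<^esub>"
    using assms(3) by (auto simp: mon_iff_hom_one[OF assms(1,2)] hom_def)
  then obtain Q :: "nat monoid" and \<phi>
    where Q: "group Q" "finite (carrier Q)" "\<phi> \<in> hom K Q" "\<phi> (f g) \<noteq> \<one>\<^bsub>Q\<^esub>"
    using assms(4) unfolding homs_to_finite_separate_def by blast
  moreover have "\<phi> \<circ> f \<in> hom G Q" using assms(3) Q(3) by (auto simp: mon_def intro: Group.hom_compose)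
  ultimately show "\<exists>(P :: nat monoid) f. group P \<and> finite (carrier P) \<and> f \<in> hom G P \<and> f g \<noteq> \<one>\<^bsub>P\<^esub>"
    using assms(1) by (metis comp_apply)
qed

text \<open>A product of finitely many finite groups is finite, so one homomorphism can keep any
  finite set of nontrivial elements nontrivial. Applied to the elements
  \<open>x \<otimes> inv y\<close> with \<open>x\<close>, \<open>y\<close> in \<open>A\<close>, this
  makes it injective on \<open>A\<close>.\<close>

lemma LEF_group_if_homs_to_finite_separate:
  fixes G (structure)
  assumes "group G" "homs_to_finite_separate G"
  shows "LEF_group G"
proof -
  interpret group G by fact
  have sep: "\<exists>(Q :: nat monoid) \<phi>. group Q \<and> finite (carrier Q) \<and> \<phi> \<in> hom G Q \<and>
      (\<forall>g\<in>S. \<phi> g \<noteq> \<one>\<^bsub>Q\<^esub>)" if "finite S" "S \<subseteq> carrier G - {\<one>}" for S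
    using that
  proof (induction S)
    case empty
    define Q :: "nat monoid" where "Q = \<lparr>carrier = {0}, monoid.mult = (\<lambda>_ _. 0), one = 0\<rparr>"
    have "group Q" "finite (carrier Q)" by (auto simp: Q_def intro: groupI)
    then show ?case by (intro exI[of _ Q] exI[of _ "\<lambda>_. \<one>\<^bsub>Q\<^esub>"]) (auto simp: hom_def group.is_monoid)
  next
    case (insert g S)
    then obtain Q :: "nat monoid" and \<phi> where
      Q: "group Q" "finite (carrier Q)" "\<phi> \<in> hom G Q" "\<forall>g\<in>S. \<phi> g \<noteq> \<one>\<^bsub>Q\<^esub>" by auto
    obtain Q' :: "nat monoid" and \<phi>' where
      Q': "group Q'" "finite (carrier Q')" "\<phi>' \<in> hom G Q'" "\<phi>' g \<noteq> \<one>\<^bsub>Q'\<^esub>"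
      using assms(2) insert.prems unfolding homs_to_finite_separate_def by blast
    let ?P = "Q \<times>\<times> Q'"
    have P: "group ?P" "finite (carrier ?P)" using Q Q' by (simp_all add: DirProd_group)
    obtain R :: "nat monoid" and h where
      R: "group R" "finite (carrier R)" "h \<in> hom ?P R" "inj_on h (carrier ?P)"
      using finite_group_nat_copy[OF P] .
    have hom: "(\<lambda>x. (\<phi> x, \<phi>' x)) \<in> hom G ?P" using Q Q' by (simp add: hom_paired)
    have "h (\<phi> x, \<phi>' x) \<noteq> \<one>\<^bsub>R\<^esub>" if "x \<in> insert g S" for x
    proof -
      have "(\<phi> x, \<phi>' x) \<in> carrier ?P" "(\<phi> x, \<phi>' x) \<noteq> \<one>\<^bsub>?P\<^esub>"
        using that Q Q' insert.prems hom_in_carrier[OF hom] by auto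
      then show ?thesis
        using R(4) hom_one[OF R(3) P(1) R(1)] P(1) unfolding inj_on_def
        by (metis group.is_monoid monoid.one_closed)
    qed
    with R show ?case
      using Group.hom_compose[OF hom R(3)]
      by (intro exI[of _ R] exI[of _ "\<lambda>x. h (\<phi> x, \<phi>' x)"]) (auto simp: comp_def)
  qed
  show ?thesis
    unfolding LEF_group_def
  proof (intro conjI allI impI)
    fix A assume A: "finite A \<and> A \<subseteq> carrier G"
    let ?S = "{x \<otimes> inv y | x y. x \<in> A \<and> y \<in> A} - {\<one>}"
    have "finite ?S" "?S \<subseteq> carrier G - {\<one>}"
      using A by (auto intro!: finite_Diff finite_image_set2)
    from sep[OF this] obtain Q :: "nat monoid" and \<phi> where
      Q: "group Q" "finite (carrier Q)" "\<phi> \<in> hom G Q" "\<forall>g\<in>?S. \<phi> g \<noteq> \<one>\<^bsub>Q\<^esub>"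
      by (elim exE conjE)
    interpret \<phi>: group_hom G Q \<phi> using Q by (simp add: group_hom_def group_hom_axioms_def is_group)
    have "inj_on \<phi> A"
    proof (rule inj_onI, rule ccontr)
      fix x y assume xy: "x \<in> A" "y \<in> A" "\<phi> x = \<phi> y" "x \<noteq> y"
      then have c: "x \<in> carrier G" "y \<in> carrier G" using A by auto
      then have "x \<otimes> inv y \<noteq> \<one>" using xy(4) by (metis inv_equality inv_inv inv_closed)
      then have "\<phi> (x \<otimes> inv y) \<noteq> \<one>\<^bsub>Q\<^esub>" using Q(4) xy by auto
      moreover have "\<phi> (x \<otimes> inv y) = \<one>\<^bsub>Q\<^esub>" using c xy(3) by (simp add: \<phi>.H.r_inv)
      ultimately show False by simp
    qed
    moreover have "\<phi> \<in> A \<rightarrow> carrier Q" using A by auto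
    moreover have "\<forall>g\<in>A. \<forall>h\<in>A. g \<otimes> h \<in> A \<longrightarrow> \<phi> (g \<otimes> h) = \<phi> g \<otimes>\<^bsub>Q\<^esub> \<phi> h"
      using A by (auto simp: subset_iff)
    ultimately show "\<exists>(Q :: nat monoid) \<phi>. group Q \<and> finite (carrier Q) \<and> \<phi> \<in> A \<rightarrow> carrier Q \<and>
      inj_on \<phi> A \<and> (\<forall>g\<in>A. \<forall>h\<in>A. g \<otimes> h \<in> A \<longrightarrow> \<phi> (g \<otimes> h) = \<phi> g \<otimes>\<^bsub>Q\<^esub> \<phi> h)"
      using Q(1,2) by blast
  qed (fact assms(1))
qed

lemma LEF_group_DirProd:
  fixes G :: "('a, 'm) monoid_scheme" and K :: "('k, 'n) monoid_scheme"
  assumes "LEF_group G" "LEF_group K"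
  shows "LEF_group (G \<times>\<times> K)"
proof -
  have gr: "group G" "group K" using assms by (simp_all add: LEF_group_def)
  show ?thesis
  proof (rule LEF_groupI[OF DirProd_group[OF gr]])
    fix A assume A: "finite A" "A \<subseteq> carrier (G \<times>\<times> K)"
    have fin: "finite (fst ` A)" "fst ` A \<subseteq> carrier G" "finite (snd ` A)" "snd ` A \<subseteq> carrier K"
      using A by auto
    obtain P :: "nat monoid" and f where
      P: "group P" "finite (carrier P)" "f \<in> fst ` A \<rightarrow> carrier P" "inj_on f (fst ` A)"
        "\<forall>x\<in>fst ` A. \<forall>y\<in>fst ` A. x \<otimes>\<^bsub>G\<^esub> y \<in> fst ` A \<longrightarrow> f (x \<otimes>\<^bsub>G\<^esub> y) = f x \<otimes>\<^bsub>P\<^esub> f y"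
      using LEF_groupE[OF assms(1) fin(1,2)] .
    obtain Q :: "nat monoid" and h where
      Q: "group Q" "finite (carrier Q)" "h \<in> snd ` A \<rightarrow> carrier Q" "inj_on h (snd ` A)"
        "\<forall>x\<in>snd ` A. \<forall>y\<in>snd ` A. x \<otimes>\<^bsub>K\<^esub> y \<in> snd ` A \<longrightarrow> h (x \<otimes>\<^bsub>K\<^esub> y) = h x \<otimes>\<^bsub>Q\<^esub> h y"
      using LEF_groupE[OF assms(2) fin(3,4)] .
    let ?\<phi> = "\<lambda>(x, y). (f x, h y)"
    have PQ: "group (P \<times>\<times> Q)" "finite (carrier (P \<times>\<times> Q))"
      using P Q by (simp_all add: DirProd_group)
    \<comment> \<open>The product is carried by pairs of naturals. Being finite, it is separated by
      its own identity map, hence LEF, which is all that \<open>LEF_groupI\<close> asks of a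
      target.\<close>
    have "homs_to_finite_separate (P \<times>\<times> Q)"
    proof (rule homs_to_finite_separateI)
      fix x assume "x \<noteq> \<one>\<^bsub>P \<times>\<times> Q\<^esub>"
      moreover have "id \<in> hom (P \<times>\<times> Q) (P \<times>\<times> Q)" by (auto simp: hom_def)
      ultimately show "\<exists>(R :: (nat \<times> nat) monoid) f. group R \<and> finite (carrier R) \<and>
        f \<in> hom (P \<times>\<times> Q) R \<and> f x \<noteq> \<one>\<^bsub>R\<^esub>"
        using PQ by (metis id_apply)
    qed
    then have "LEF_group (P \<times>\<times> Q)"
      using PQ(1) LEF_group_if_homs_to_finite_separate by blast
    moreover have "?\<phi> \<in> A \<rightarrow> carrier (P \<times>\<times> Q)" using P(3) Q(3) by (force simp: Pi_iff)
    moreover have "inj_on ?\<phi> A"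
    proof (rule inj_onI)
      fix p q assume "p \<in> A" "q \<in> A" "?\<phi> p = ?\<phi> q"
      then show "p = q" using inj_onD[OF P(4), of "fst p" "fst q"] inj_onD[OF Q(4), of "snd p" "snd q"]
        by (auto simp: case_prod_beta prod_eq_iff)
    qed
    moreover have "?\<phi> (p \<otimes>\<^bsub>G \<times>\<times> K\<^esub> q) = ?\<phi> p \<otimes>\<^bsub>P \<times>\<times> Q\<^esub> ?\<phi> q"
      if "p \<in> A" "q \<in> A" "p \<otimes>\<^bsub>G \<times>\<times> K\<^esub> q \<in> A" for p q
      using that P(5) Q(5) by (cases p, cases q) (simp, metis fst_conv snd_conv image_eqI)
    ultimately show "\<exists>(R :: (nat \<times> nat) monoid) \<phi>. LEF_group R \<and> \<phi> \<in> A \<rightarrow> carrier R \<and> inj_on \<phi> A \<and>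
      (\<forall>g\<in>A. \<forall>h\<in>A. g \<otimes>\<^bsub>G \<times>\<times> K\<^esub> h \<in> A \<longrightarrow> \<phi> (g \<otimes>\<^bsub>G \<times>\<times> K\<^esub> h) = \<phi> g \<otimes>\<^bsub>R\<^esub> \<phi> h)"
      by blast
  qed
qed

section \<open>Automorphism groups and semidirect products\<close>

lemma mult_AutoGroup:
  assumes "f \<in> auto G" "h \<in> auto G" "x \<in> carrier G"
  shows "(f \<otimes>\<^bsub>AutoGroup G\<^esub> h) x = f (h x)"
  using assms by (simp add: AutoGroup_def BijGroup_def auto_def compose_eq)

lemma carrier_AutoGroup: "carrier (AutoGroup G) = auto G"
  by (simp add: AutoGroup_def)

lemma one_AutoGroup: "\<one>\<^bsub>AutoGroup G\<^esub> = restrict (\<lambda>x. x) (carrier G)"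
  by (simp add: AutoGroup_def BijGroup_def)

lemma auto_closed: "f \<in> auto G \<Longrightarrow> x \<in> carrier G \<Longrightarrow> f x \<in> carrier G"
  by (auto simp: auto_def hom_def)

lemma auto_eqI:
  assumes "f \<in> auto G" "h \<in> auto G" "\<And>x. x \<in> carrier G \<Longrightarrow> f x = h x"
  shows "f = h"
  using assms by (intro extensionalityI[of _ "carrier G"]) (auto simp: auto_def Bij_def)

lemma inv_AutoGroup_apply:
  assumes "group G" "f \<in> auto G" "x \<in> carrier G"
  shows "(inv\<^bsub>AutoGroup G\<^esub> f) (f x) = x" "f ((inv\<^bsub>AutoGroup G\<^esub> f) x) = x"
proof -
  interpret A: group "AutoGroup G" by (rule group.AutoGroup[OF assms(1)])
  have f: "f \<in> carrier (AutoGroup G)" using assms(2) by (simp add: carrier_AutoGroup)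
  have i: "inv\<^bsub>AutoGroup G\<^esub> f \<in> auto G"
    using A.inv_closed[OF f] by (simp add: carrier_AutoGroup)
  show "(inv\<^bsub>AutoGroup G\<^esub> f) (f x) = x"
    using mult_AutoGroup[OF i assms(2,3)] A.l_inv[OF f] assms(3) by (simp add: one_AutoGroup)
  show "f ((inv\<^bsub>AutoGroup G\<^esub> f) x) = x"
    using mult_AutoGroup[OF assms(2) i assms(3)] A.r_inv[OF f] assms(3) by (simp add: one_AutoGroup)
qed

text \<open>The group of automorphisms acts on the finite set of homomorphisms to a finite group.\<close>

lemma homs_to_finite_separate_AutoGroup:
  fixes G (structure)
  assumes "finitely_generated_group G" "homs_to_finite_separate G"
  shows "homs_to_finite_separate (AutoGroup G)"
proof (rule homs_to_finite_separateI)
  fix \<beta> assume \<beta>: "\<beta> \<in> carrier (AutoGroup G)" "\<beta> \<noteq> \<one>\<^bsub>AutoGroup G\<^esub>"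
  obtain S where S: "group G" "finite S" "S \<subseteq> carrier G" "generate G S = carrier G"
    using assms(1) unfolding finitely_generated_group_def by blast
  interpret group G by fact
  interpret A: group "AutoGroup G" by (rule AutoGroup)
  have \<beta>a: "\<beta> \<in> auto G" using \<beta> by (simp add: carrier_AutoGroup)
  have "\<exists>s\<in>carrier G. \<beta> s \<noteq> s"
    using \<beta>(2) auto_eqI[OF \<beta>a id_in_auto] by (auto simp: one_AutoGroup)
  then obtain s where s: "s \<in> carrier G" "\<beta> s \<noteq> s" by blast
  have c: "\<beta> s \<in> carrier G" using auto_closed[OF \<beta>a s(1)] .
  \<comment> \<open>A finite quotient \<open>f\<close> in which this element survives has
    \<open>f (\<beta> s) \<noteq> f s\<close>, so that precomposition with \<beta> moves the point
    \<open>f\<close> of the set of homomorphisms.\<close>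
  have "\<beta> s \<otimes> inv s \<noteq> \<one>" using s c by (metis inv_equality inv_inv inv_closed)
  then obtain P :: "nat monoid" and f
    where P: "group P" "finite (carrier P)" "f \<in> hom G P" "f (\<beta> s \<otimes> inv s) \<noteq> \<one>\<^bsub>P\<^esub>"
    using assms(2) s c unfolding homs_to_finite_separate_def by (meson inv_closed m_closed)
  interpret f: group_hom G P f using P by (simp add: group_hom_def group_hom_axioms_def is_group)
  have f\<beta>: "f (\<beta> s) \<noteq> f s" using P(4) s c by (auto simp: f.H.r_inv)
  \<comment> \<open>Extensionality gives each homomorphism a single representative. It is then
    determined by its values on the finite generating set \<open>S\<close>, which bounds
    \<open>E\<close> by \<open>S \<rightarrow>\<^sub>E carrier P\<close>.\<close>
  define E where "E = hom G P \<inter> extensional (carrier G)"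
  have "finite E"
  proof (rule inj_on_finite)
    show "inj_on (\<lambda>h. restrict h S) E"
    proof (rule inj_onI)
      fix h h' assume h: "h \<in> E" "h' \<in> E" "restrict h S = restrict h' S"
      show "h = h'"
      proof (rule extensionalityI[of _ "carrier G"])
        fix x assume "x \<in> carrier G"
        moreover have "h s = h' s" if "s \<in> S" for s using fun_cong[OF h(3), of s] that by simp
        ultimately show "h x = h' x"
          using hom_eq_on_generate[OF is_group P(1) _ _ S(3), of h h' x] h S(4) by (simp add: E_def)
      qed (use h in \<open>auto simp: E_def\<close>)
    qed
    show "(\<lambda>h. restrict h S) ` E \<subseteq> S \<rightarrow>\<^sub>E carrier P"
      using S(3) by (auto simp: E_def hom_def)
    show "finite (S \<rightarrow>\<^sub>E carrier P)" using S(2) P(2) by (simp add: finite_PiE)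
  qed
  \<comment> \<open>Precomposition reverses products; the inverse turns it into a left action. The
    restriction to \<open>E\<close> is what membership in \<open>Bij E\<close> demands.\<close>
  define \<Phi> where "\<Phi> \<gamma> = (\<lambda>h\<in>E. compose (carrier G) h (inv\<^bsub>AutoGroup G\<^esub> \<gamma>))" for \<gamma>
  have E_comp: "compose (carrier G) h \<gamma> \<in> E" if "h \<in> E" "\<gamma> \<in> auto G" for h \<gamma>
    using that hom_compose[of \<gamma> G h P] by (auto simp: E_def auto_def)
  have \<Phi>_E: "\<Phi> \<gamma> h \<in> E" if "h \<in> E" "\<gamma> \<in> auto G" for h \<gamma>
    using E_comp[OF that(1), of "inv\<^bsub>AutoGroup G\<^esub> \<gamma>"] A.inv_closed[of \<gamma>] that
    by (simp add: \<Phi>_def carrier_AutoGroup)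
  have \<Phi>_mult: "\<Phi> (\<gamma> \<otimes>\<^bsub>AutoGroup G\<^esub> \<gamma>') h = \<Phi> \<gamma> (\<Phi> \<gamma>' h)"
    if "h \<in> E" "\<gamma> \<in> auto G" "\<gamma>' \<in> auto G" for h \<gamma> \<gamma>'
  proof -
    have i: "inv\<^bsub>AutoGroup G\<^esub> \<gamma> \<in> auto G" "inv\<^bsub>AutoGroup G\<^esub> \<gamma>' \<in> auto G"
      using A.inv_closed that by (auto simp: carrier_AutoGroup)
    have "inv\<^bsub>AutoGroup G\<^esub> (\<gamma> \<otimes>\<^bsub>AutoGroup G\<^esub> \<gamma>') = inv\<^bsub>AutoGroup G\<^esub> \<gamma>' \<otimes>\<^bsub>AutoGroup G\<^esub> inv\<^bsub>AutoGroup G\<^esub> \<gamma>"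
      using that by (intro A.inv_mult_group) (auto simp: carrier_AutoGroup)
    moreover have "compose (carrier G) h (inv\<^bsub>AutoGroup G\<^esub> \<gamma>') \<in> E"
      using E_comp that i by blast
    ultimately show ?thesis
      using that i by (auto simp: \<Phi>_def compose_def fun_eq_iff mult_AutoGroup auto_closed)
  qed
  have \<Phi>_one: "\<Phi> \<one>\<^bsub>AutoGroup G\<^esub> h = h" if "h \<in> E" for h
  proof -
    have "compose (carrier G) h \<one>\<^bsub>AutoGroup G\<^esub> = h"
      using that by (auto simp: one_AutoGroup compose_def E_def extensional_def)
    then show ?thesis using that by (simp add: \<Phi>_def)
  qed
  have \<Phi>_Bij: "\<Phi> \<gamma> \<in> Bij E" if "\<gamma> \<in> auto G" for \<gamma>
  proof -
    have i: "inv\<^bsub>AutoGroup G\<^esub> \<gamma> \<in> auto G" "\<gamma> \<in> carrier (AutoGroup G)"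
      using A.inv_closed that by (auto simp: carrier_AutoGroup)
    have "bij_betw (\<Phi> \<gamma>) E E"
    proof (rule bij_betw_byWitness[where f' = "\<Phi> (inv\<^bsub>AutoGroup G\<^esub> \<gamma>)"])
      show "\<forall>a\<in>E. \<Phi> (inv\<^bsub>AutoGroup G\<^esub> \<gamma>) (\<Phi> \<gamma> a) = a"
        using \<Phi>_mult[OF _ i(1) that] \<Phi>_one A.l_inv[OF i(2)] by simp
      show "\<forall>a\<in>E. \<Phi> \<gamma> (\<Phi> (inv\<^bsub>AutoGroup G\<^esub> \<gamma>) a) = a"
        using \<Phi>_mult[OF _ that i(1)] \<Phi>_one A.r_inv[OF i(2)] by simp
    qed (use \<Phi>_E that i in auto)
    then show ?thesis by (simp add: Bij_def \<Phi>_def)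
  qed
  have "\<Phi> \<in> hom (AutoGroup G) (BijGroup E)"
  proof (rule homI)
    show "\<Phi> \<gamma> \<in> carrier (BijGroup E)" if "\<gamma> \<in> carrier (AutoGroup G)" for \<gamma>
      using \<Phi>_Bij that by (simp add: carrier_AutoGroup BijGroup_def)
    fix \<gamma> \<gamma>' assume g: "\<gamma> \<in> carrier (AutoGroup G)" "\<gamma>' \<in> carrier (AutoGroup G)"
    then have "\<gamma> \<in> auto G" "\<gamma>' \<in> auto G" by (auto simp: carrier_AutoGroup)
    then have "compose E (\<Phi> \<gamma>) (\<Phi> \<gamma>') h = \<Phi> (\<gamma> \<otimes>\<^bsub>AutoGroup G\<^esub> \<gamma>') h" for h
      using \<Phi>_mult[of h] by (cases "h \<in> E") (simp_all add: compose_def \<Phi>_def)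
    then show "\<Phi> (\<gamma> \<otimes>\<^bsub>AutoGroup G\<^esub> \<gamma>') = \<Phi> \<gamma> \<otimes>\<^bsub>BijGroup E\<^esub> \<Phi> \<gamma>'"
      using \<Phi>_Bij g by (auto simp: carrier_AutoGroup BijGroup_def)
  qed
  moreover have "\<Phi> \<beta> \<noteq> \<one>\<^bsub>BijGroup E\<^esub>"
  proof
    assume "\<Phi> \<beta> = \<one>\<^bsub>BijGroup E\<^esub>"
    moreover have fE: "restrict f (carrier G) \<in> E"
      using P(3) by (auto simp: E_def hom_def)
    ultimately have "\<Phi> \<beta> (restrict f (carrier G)) = restrict f (carrier G)"
      by (simp add: BijGroup_def)
    then have "\<Phi> \<beta> (restrict f (carrier G)) (\<beta> s) = f (\<beta> s)" using c by simp
    moreover have "\<Phi> \<beta> (restrict f (carrier G)) (\<beta> s) = f s"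
      using fE c s by (simp add: \<Phi>_def compose_def inv_AutoGroup_apply[OF is_group \<beta>a])
    ultimately show False using f\<beta> by simp
  qed
  moreover have "finite (carrier (BijGroup E))"
  proof (rule finite_subset)
    show "carrier (BijGroup E) \<subseteq> E \<rightarrow>\<^sub>E E"
      by (auto simp: BijGroup_def Bij_def bij_betw_def PiE_def)
  qed (simp add: \<open>finite E\<close> finite_PiE)
  ultimately show "\<exists>(P :: (('a \<Rightarrow> nat) \<Rightarrow> 'a \<Rightarrow> nat) monoid) f. group P \<and> finite (carrier P) \<and>
      f \<in> hom (AutoGroup G) P \<and> f \<beta> \<noteq> \<one>\<^bsub>P\<^esub>"
    using group_BijGroup A.is_group by blast
qed

lemma finitely_generated_group_epi:
  assumes "finitely_generated_group G" "group K" "f \<in> hom G K" "f ` carrier G = carrier K"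
  shows "finitely_generated_group K"
proof -
  obtain S where S: "group G" "finite S" "S \<subseteq> carrier G" "generate G S = carrier G"
    using assms(1) unfolding finitely_generated_group_def by blast
  interpret f: group_hom G K f using S assms by (simp add: group_hom_def group_hom_axioms_def)
  show ?thesis
    unfolding finitely_generated_group_def
  proof (intro conjI exI)
    show "generate K (f ` S) = carrier K" using f.generate_img[OF S(3)] S(4) assms(4) by simp
  qed (use S assms in auto)
qed

section \<open>Semidirect products with a locally inner action\<close>

lemma group_semidirect:
  assumes "group N" "group G"
    and hom: "\<And>g. g \<in> carrier G \<Longrightarrow> \<theta> g \<in> hom N N"
    and mult: "\<And>g h n. g \<in> carrier G \<Longrightarrow> h \<in> carrier G \<Longrightarrow> n \<in> carrier N \<Longrightarrow>
       \<theta> (g \<otimes>\<^bsub>G\<^esub> h) n = \<theta> g (\<theta> h n)"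
    and one: "\<And>n. n \<in> carrier N \<Longrightarrow> \<theta> \<one>\<^bsub>G\<^esub> n = n"
  shows "group (semidirect N G \<theta>)"
proof -
  interpret N: group N by fact
  interpret G: group G by fact
  have cl: "\<theta> g n \<in> carrier N" if "g \<in> carrier G" "n \<in> carrier N" for g n
    using hom_in_carrier[OF hom[OF that(1)] that(2)] .
  have tm: "\<theta> g (n \<otimes>\<^bsub>N\<^esub> n') = \<theta> g n \<otimes>\<^bsub>N\<^esub> \<theta> g n'" if "g \<in> carrier G" "n \<in> carrier N" "n' \<in> carrier N" for g n n'
    using hom_mult[OF hom[OF that(1)] that(2,3)] .
  show ?thesis
  proof (rule groupI)
    fix x assume x: "x \<in> carrier (semidirect N G \<theta>)"
    then obtain n g where ng: "x = (n, g)" "n \<in> carrier N" "g \<in> carrier G"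
      by (auto simp: semidirect_def)
    let ?y = "(\<theta> (inv\<^bsub>G\<^esub> g) (inv\<^bsub>N\<^esub> n), inv\<^bsub>G\<^esub> g)"
    have t1: "\<theta> (inv\<^bsub>G\<^esub> g) (inv\<^bsub>N\<^esub> n) \<otimes>\<^bsub>N\<^esub> \<theta> (inv\<^bsub>G\<^esub> g) n = \<one>\<^bsub>N\<^esub>"
      using ng tm[of "inv\<^bsub>G\<^esub> g" "inv\<^bsub>N\<^esub> n" n] hom_one[OF hom assms(1,1)] by simp
    show "\<exists>y\<in>carrier (semidirect N G \<theta>). y \<otimes>\<^bsub>semidirect N G \<theta>\<^esub> x = \<one>\<^bsub>semidirect N G \<theta>\<^esub>"
      using ng cl t1 by (intro bexI[of _ ?y]) (auto simp: semidirect_def)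
  qed (auto simp: semidirect_def cl tm mult one N.m_assoc G.m_assoc)
qed

text \<open>Where \<open>a g\<close> may be replaced by \<open>t g \<in> N\<close>, the action is inner and the semidirect product
  becomes direct by way of \<open>(n, g) \<mapsto> (n t(g), g)\<close>.\<close>

lemma LEF_group_semidirect_locally_inner:
  fixes A :: "('b, 'n) monoid_scheme" and \<Gamma> :: "('a, 'm) monoid_scheme"
  assumes A: "group A" and N: "subgroup N A" and a: "a \<in> hom \<Gamma> A"
    and normal: "\<And>g n. g \<in> carrier \<Gamma> \<Longrightarrow> n \<in> N \<Longrightarrow> a g \<otimes>\<^bsub>A\<^esub> n \<otimes>\<^bsub>A\<^esub> inv\<^bsub>A\<^esub> (a g) \<in> N"
    and LEF: "LEF_group (A\<lparr>carrier := N\<rparr>)" "LEF_group \<Gamma>"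
    and inner: "\<And>F B. finite F \<Longrightarrow> F \<subseteq> carrier \<Gamma> \<Longrightarrow> finite B \<Longrightarrow> B \<subseteq> N \<Longrightarrow>
      \<exists>t \<in> F \<rightarrow> N. (\<forall>g\<in>F. \<forall>h\<in>F. g \<otimes>\<^bsub>\<Gamma>\<^esub> h \<in> F \<longrightarrow> t (g \<otimes>\<^bsub>\<Gamma>\<^esub> h) = t g \<otimes>\<^bsub>A\<^esub> t h) \<and>
        (\<forall>g\<in>F. \<forall>n\<in>B. a g \<otimes>\<^bsub>A\<^esub> n \<otimes>\<^bsub>A\<^esub> inv\<^bsub>A\<^esub> (a g) = t g \<otimes>\<^bsub>A\<^esub> n \<otimes>\<^bsub>A\<^esub> inv\<^bsub>A\<^esub> (t g))"
  shows "LEF_group (semidirect (A\<lparr>carrier := N\<rparr>) \<Gamma> (\<lambda>g n. a g \<otimes>\<^bsub>A\<^esub> n \<otimes>\<^bsub>A\<^esub> inv\<^bsub>A\<^esub> (a g)))"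
    (is "LEF_group ?S")
proof -
  interpret A: group A by fact
  interpret N: subgroup N A by fact
  have \<Gamma>: "group \<Gamma>" using LEF(2) by (simp add: LEF_group_def)
  interpret a: group_hom \<Gamma> A a using \<Gamma> A a by (simp add: group_hom_def group_hom_axioms_def)
  have "group ?S"
  proof (rule group_semidirect[OF A.subgroup_imp_group[OF N] \<Gamma>])
    fix g h n assume "g \<in> carrier \<Gamma>" "h \<in> carrier \<Gamma>" "n \<in> carrier (A\<lparr>carrier := N\<rparr>)"
    then show "a (g \<otimes>\<^bsub>\<Gamma>\<^esub> h) \<otimes>\<^bsub>A\<^esub> n \<otimes>\<^bsub>A\<^esub> inv\<^bsub>A\<^esub> (a (g \<otimes>\<^bsub>\<Gamma>\<^esub> h)) =
        a g \<otimes>\<^bsub>A\<^esub> (a h \<otimes>\<^bsub>A\<^esub> n \<otimes>\<^bsub>A\<^esub> inv\<^bsub>A\<^esub> (a h)) \<otimes>\<^bsub>A\<^esub> inv\<^bsub>A\<^esub> (a g)"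
      by (simp add: A.inv_mult_group A.m_assoc)
  next
    fix g assume "g \<in> carrier \<Gamma>"
    then show "(\<lambda>n. a g \<otimes>\<^bsub>A\<^esub> n \<otimes>\<^bsub>A\<^esub> inv\<^bsub>A\<^esub> (a g)) \<in> hom (A\<lparr>carrier := N\<rparr>) (A\<lparr>carrier := N\<rparr>)"
      using normal by (auto intro!: homI simp: A.m_assoc A.inv_solve_left simp flip: A.m_assoc[of "inv\<^bsub>A\<^esub> (a g)" "a g"])
  qed simp
  then show ?thesis
  proof (rule LEF_groupI)
    fix W assume W: "finite W" "W \<subseteq> carrier ?S"
    have F: "finite (snd ` W)" "snd ` W \<subseteq> carrier \<Gamma>" "finite (fst ` W)" "fst ` W \<subseteq> N"
      using W by (auto simp: semidirect_def)
    obtain t where t: "t \<in> snd ` W \<rightarrow> N"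
      "\<And>g h. g \<in> snd ` W \<Longrightarrow> h \<in> snd ` W \<Longrightarrow> g \<otimes>\<^bsub>\<Gamma>\<^esub> h \<in> snd ` W \<Longrightarrow> t (g \<otimes>\<^bsub>\<Gamma>\<^esub> h) = t g \<otimes>\<^bsub>A\<^esub> t h"
      "\<And>g n. g \<in> snd ` W \<Longrightarrow> n \<in> fst ` W \<Longrightarrow>
        a g \<otimes>\<^bsub>A\<^esub> n \<otimes>\<^bsub>A\<^esub> inv\<^bsub>A\<^esub> (a g) = t g \<otimes>\<^bsub>A\<^esub> n \<otimes>\<^bsub>A\<^esub> inv\<^bsub>A\<^esub> (t g)"
      using inner[OF F] by metis
    let ?K = "(A\<lparr>carrier := N\<rparr>) \<times>\<times> \<Gamma>"
    let ?\<phi> = "\<lambda>(n, g). (n \<otimes>\<^bsub>A\<^esub> t g, g)"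
    have "?\<phi> \<in> W \<rightarrow> carrier ?K" using F t(1) by (fastforce simp: Pi_iff)
    moreover have "inj_on ?\<phi> W"
    proof (rule inj_onI)
      fix p q assume pq: "p \<in> W" "q \<in> W" "?\<phi> p = ?\<phi> q"
      obtain n g m where [simp]: "p = (n, g)" "q = (m, g)" and e: "n \<otimes>\<^bsub>A\<^esub> t g = m \<otimes>\<^bsub>A\<^esub> t g"
        using pq(3) by (cases p, cases q) auto
      have "n \<in> N" "m \<in> N" "t g \<in> N" using pq F t(1) by (force simp: Pi_iff)+
      then show "p = q" using e by (simp add: A.right_cancel)
    qed
    moreover have "?\<phi> (p \<otimes>\<^bsub>?S\<^esub> q) = ?\<phi> p \<otimes>\<^bsub>?K\<^esub> ?\<phi> q"
      if pq: "p \<in> W" "q \<in> W" "p \<otimes>\<^bsub>?S\<^esub> q \<in> W" for p q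
    proof -
      obtain n g m h where p: "p = (n, g)" and q: "q = (m, h)" by fastforce
      have "snd (p \<otimes>\<^bsub>?S\<^esub> q) = g \<otimes>\<^bsub>\<Gamma>\<^esub> h" by (simp add: p q semidirect_def)
      then have in_W: "g \<in> snd ` W" "h \<in> snd ` W" "n \<in> fst ` W" "m \<in> fst ` W" "g \<otimes>\<^bsub>\<Gamma>\<^esub> h \<in> snd ` W"
        using imageI[OF pq(1), of fst] imageI[OF pq(1), of snd] imageI[OF pq(2), of fst]
          imageI[OF pq(2), of snd] imageI[OF pq(3), of snd] by (simp_all add: p q)
      then have N: "n \<in> N" "m \<in> N" "t g \<in> N" "t h \<in> N"
        using F(4) t(1) by (blast dest: Pi_mem)+
      then have c: "n \<in> carrier A" "m \<in> carrier A" "t g \<in> carrier A" "t h \<in> carrier A" by auto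
      \<comment> \<open>With \<open>a g\<close> replaced by \<open>t g\<close>, the trailing
        \<open>inv (t g)\<close> of the twist cancels against the first factor of
        \<open>t (g h) = t g t h\<close>.\<close>
      have "n \<otimes>\<^bsub>A\<^esub> (a g \<otimes>\<^bsub>A\<^esub> m \<otimes>\<^bsub>A\<^esub> inv\<^bsub>A\<^esub> (a g)) \<otimes>\<^bsub>A\<^esub> t (g \<otimes>\<^bsub>\<Gamma>\<^esub> h)
          = n \<otimes>\<^bsub>A\<^esub> (t g \<otimes>\<^bsub>A\<^esub> m \<otimes>\<^bsub>A\<^esub> inv\<^bsub>A\<^esub> (t g)) \<otimes>\<^bsub>A\<^esub> (t g \<otimes>\<^bsub>A\<^esub> t h)"
        using t(2,3) in_W by simp
      also have "\<dots> = n \<otimes>\<^bsub>A\<^esub> t g \<otimes>\<^bsub>A\<^esub> (m \<otimes>\<^bsub>A\<^esub> t h)"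
      proof -
        have "inv\<^bsub>A\<^esub> (t g) \<otimes>\<^bsub>A\<^esub> (t g \<otimes>\<^bsub>A\<^esub> t h) = t h"
          using c by (simp flip: A.m_assoc)
        then show ?thesis using c by (simp add: A.m_assoc)
      qed
      finally show ?thesis by (simp add: p q semidirect_def)
    qed
    moreover have "LEF_group ?K" using LEF by (rule LEF_group_DirProd)
    ultimately show "\<exists>(K :: ('b \<times> 'a) monoid) \<phi>. LEF_group K \<and> \<phi> \<in> W \<rightarrow> carrier K \<and> inj_on \<phi> W \<and>
        (\<forall>g\<in>W. \<forall>h\<in>W. g \<otimes>\<^bsub>?S\<^esub> h \<in> W \<longrightarrow> \<phi> (g \<otimes>\<^bsub>?S\<^esub> h) = \<phi> g \<otimes>\<^bsub>K\<^esub> \<phi> h)"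
      by blast
  qed
qed

section \<open>Permutations acting on labelled copies of a group\<close>

text \<open>The finite set supplied by the LEF action is copied into \<open>X\<close> so that
  \<open>\<pi>\<close> becomes the inclusion. Its points outside the image of \<open>\<pi>\<close>
  need fresh places in \<open>X\<close>, which exist if \<open>X\<close> is infinite; if
  \<open>X\<close> is finite, \<open>\<alpha>\<close> can serve as its own approximation.\<close>

lemma LEF_action_local_permutations:
  assumes "LEF_action \<Gamma> X \<alpha>" "finite F" "F \<subseteq> carrier \<Gamma>" "finite Z" "Z \<subseteq> X"
  obtains Y \<sigma> where "finite Y" "Y \<subseteq> X" "\<And>g. g \<in> F \<Longrightarrow> \<sigma> g permutes Y"
    "\<And>g h. g \<in> F \<Longrightarrow> h \<in> F \<Longrightarrow> g \<otimes>\<^bsub>\<Gamma>\<^esub> h \<in> F \<Longrightarrow> \<sigma> (g \<otimes>\<^bsub>\<Gamma>\<^esub> h) = \<sigma> g \<circ> \<sigma> h"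
    "\<And>g x. g \<in> F \<Longrightarrow> x \<in> Z \<Longrightarrow> \<sigma> g x = \<alpha> g x"
proof -
  interpret \<alpha>: group_action \<Gamma> X \<alpha> using assms(1) by (simp add: LEF_action_def)
  show ?thesis
  proof (cases "finite X")
    case True
    \<comment> \<open>\<open>permutes\<close> requires the identity outside \<open>X\<close>, where
      the extensional \<open>\<alpha> g\<close> is undefined.\<close>
    define \<sigma> where "\<sigma> g x = (if x \<in> X then \<alpha> g x else x)" for g x
    show ?thesis
    proof (rule that[of X \<sigma>])
      fix g assume "g \<in> F"
      then have g: "g \<in> carrier \<Gamma>" using assms(3) by auto
      have "bij_betw (\<sigma> g) X X \<longleftrightarrow> bij_betw (\<alpha> g) X X"
        by (rule bij_betw_cong) (simp add: \<sigma>_def)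
      then show "\<sigma> g permutes X"
        using \<alpha>.bij_prop0[OF g] by (intro bij_imp_permutes) (auto simp: \<sigma>_def Bij_def)
    next
      fix g h assume "g \<in> F" "h \<in> F"
      then have gh: "g \<in> carrier \<Gamma>" "h \<in> carrier \<Gamma>" using assms(3) by auto
      then have "\<alpha> h x \<in> X" "\<alpha> (g \<otimes>\<^bsub>\<Gamma>\<^esub> h) x = \<alpha> g (\<alpha> h x)" if "x \<in> X" for x
        using \<alpha>.composition_rule[OF that gh] \<alpha>.element_image[OF gh(2) that] by simp_all
      then show "\<sigma> (g \<otimes>\<^bsub>\<Gamma>\<^esub> h) = \<sigma> g \<circ> \<sigma> h" by (auto simp: \<sigma>_def)
    qed (use True assms(5) in \<open>auto simp: \<sigma>_def\<close>)
  next
    case False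
    \<comment> \<open>A LEF action controls \<open>\<alpha> g x\<close> only if it stays in the
      chosen finite set. Adding the translates of \<open>Z\<close> under \<open>F\<close> guarantees
      this for every \<open>x\<close> in \<open>Z\<close>.\<close>
    define Z' where "Z' = Z \<union> (\<Union>g\<in>F. \<alpha> g ` Z)"
    have Z': "finite Z'" "Z' \<subseteq> X"
      using assms \<alpha>.element_image[OF _ _ refl] by (auto simp: Z'_def subset_iff)
    have "\<exists>(Q :: nat monoid) (Y :: nat set) \<beta> \<rho> \<pi>.
          group Q \<and> finite (carrier Q) \<and> finite Y \<and> group_action Q Y \<beta> \<and>
          \<rho> \<in> carrier \<Gamma> \<rightarrow> carrier Q \<and> set_embedding Z' Y \<pi> \<and>
          (\<forall>g\<in>F. \<forall>h\<in>F. g \<otimes>\<^bsub>\<Gamma>\<^esub> h \<in> F \<longrightarrow> \<rho> (g \<otimes>\<^bsub>\<Gamma>\<^esub> h) = \<rho> g \<otimes>\<^bsub>Q\<^esub> \<rho> h) \<and>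
          (\<forall>g\<in>F. \<forall>x\<in>Z'. \<alpha> g x \<in> Z' \<longrightarrow> \<pi> (\<alpha> g x) = \<beta> (\<rho> g) (\<pi> x))"
      using assms Z' by (simp add: LEF_action_def)
    then obtain Q :: "nat monoid" and Yn :: "nat set" and \<beta> \<rho> \<pi> where
      Yn: "finite Yn" "group_action Q Yn \<beta>" "\<rho> \<in> carrier \<Gamma> \<rightarrow> carrier Q" "set_embedding Z' Yn \<pi>"
      and \<rho>: "\<forall>g\<in>F. \<forall>h\<in>F. g \<otimes>\<^bsub>\<Gamma>\<^esub> h \<in> F \<longrightarrow> \<rho> (g \<otimes>\<^bsub>\<Gamma>\<^esub> h) = \<rho> g \<otimes>\<^bsub>Q\<^esub> \<rho> h"
      and \<pi>: "\<forall>g\<in>F. \<forall>x\<in>Z'. \<alpha> g x \<in> Z' \<longrightarrow> \<pi> (\<alpha> g x) = \<beta> (\<rho> g) (\<pi> x)"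
      by (elim exE conjE)
    interpret \<beta>: group_action Q Yn \<beta> by fact
    have \<pi>_inj: "inj_on \<pi> Z'" "\<pi> ` Z' \<subseteq> Yn" using Yn(4) by (auto simp: set_embedding_def)
    \<comment> \<open>\<open>W\<close> provides the fresh places: as many points off
      \<open>Z'\<close> as \<open>Yn\<close> has off the image of \<open>\<pi>\<close>.\<close>
    have "infinite (X - Z')" using False Z'(1) by simp
    then obtain W where W: "finite W" "card W = card (Yn - \<pi> ` Z')" "W \<subseteq> X - Z'"
      using infinite_arbitrarily_large by metis
    then obtain k where k: "bij_betw k (Yn - \<pi> ` Z') W"
      using finite_same_card_bij[of "Yn - \<pi> ` Z'" W] Yn(1) by auto
    \<comment> \<open>On the image of \<open>\<pi>\<close> this undoes \<open>\<pi>\<close>, so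
      after transport along \<open>j\<close> the points of \<open>Z'\<close> are themselves again;
      elsewhere it is the arbitrary bijection \<open>k\<close>.\<close>
    define j where "j y = (if y \<in> \<pi> ` Z' then inv_into Z' \<pi> y else k y)" for y
    define Y where "Y = Z' \<union> W"
    have "bij_betw j (\<pi> ` Z') Z'"
      using bij_betw_inv_into[of \<pi> Z' "\<pi> ` Z'"] \<pi>_inj bij_betw_cong[of "\<pi> ` Z'" j "inv_into Z' \<pi>" Z']
      by (simp add: j_def bij_betw_def)
    moreover have "bij_betw j (Yn - \<pi> ` Z') W"
      using k bij_betw_cong[of "Yn - \<pi> ` Z'" j k W] by (simp add: j_def)
    ultimately have j: "bij_betw j Yn Y"
      using bij_betw_combine[of j "\<pi> ` Z'" Z' "Yn - \<pi> ` Z'" W] W(3) \<pi>_inj(2)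
      by (auto simp: Y_def Un_absorb1)
    have j\<pi>: "j (\<pi> x) = x" if "x \<in> Z'" for x using that \<pi>_inj(1) by (simp add: j_def)
    define i where "i = inv_into Yn j"
    have i: "bij_betw i Y Yn" "\<And>y. y \<in> Yn \<Longrightarrow> i (j y) = y" "\<And>x. x \<in> Y \<Longrightarrow> j (i x) = x"
      using j bij_betw_inv_into[OF j] bij_betw_inv_into_left[OF j] bij_betw_inv_into_right[OF j]
      by (simp_all add: i_def)
    have iY: "i x \<in> Yn" if "x \<in> Y" for x using i(1) that by (auto simp: bij_betw_def)
    have jY: "j y \<in> Y" if "y \<in> Yn" for y using j that by (auto simp: bij_betw_def)
    \<comment> \<open>The action of \<open>\<rho> g\<close> on \<open>Yn\<close>, conjugated by
      \<open>j\<close> and extended by the identity.\<close>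
    define \<sigma> where "\<sigma> g x = (if x \<in> Y then j (\<beta> (\<rho> g) (i x)) else x)" for g x
    have \<rho>F: "\<rho> g \<in> carrier Q" if "g \<in> F" for g using that Yn(3) assms(3) by auto
    show ?thesis
    proof (rule that[of Y \<sigma>])
      show "finite Y" "Y \<subseteq> X" using Z' W by (auto simp: Y_def)
    next
      fix g assume g: "g \<in> F"
      have "bij_betw (\<beta> (\<rho> g)) Yn Yn" using \<beta>.bij_prop0[OF \<rho>F[OF g]] by (simp add: Bij_def)
      then have "bij_betw (j \<circ> (\<beta> (\<rho> g) \<circ> i)) Y Y"
        using i(1) j by (metis bij_betw_trans)
      moreover have "bij_betw (\<sigma> g) Y Y \<longleftrightarrow> bij_betw (j \<circ> (\<beta> (\<rho> g) \<circ> i)) Y Y"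
        by (rule bij_betw_cong) (simp add: \<sigma>_def)
      ultimately show "\<sigma> g permutes Y"
        by (intro bij_imp_permutes) (auto simp: \<sigma>_def)
    next
      fix g h assume gh: "g \<in> F" "h \<in> F" "g \<otimes>\<^bsub>\<Gamma>\<^esub> h \<in> F"
      show "\<sigma> (g \<otimes>\<^bsub>\<Gamma>\<^esub> h) = \<sigma> g \<circ> \<sigma> h"
      proof
        fix x
        have "\<beta> (\<rho> h) (i x) \<in> Yn" if "x \<in> Y"
          using \<beta>.element_image[OF \<rho>F[OF gh(2)] iY[OF that] refl] .
        then show "\<sigma> (g \<otimes>\<^bsub>\<Gamma>\<^esub> h) x = (\<sigma> g \<circ> \<sigma> h) x"
          using \<beta>.composition_rule[OF iY \<rho>F[OF gh(1)] \<rho>F[OF gh(2)]] \<rho> gh i jY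
          by (simp add: \<sigma>_def)
      qed
    next
      fix g x assume gx: "g \<in> F" "x \<in> Z"
      then have z: "x \<in> Z'" "\<alpha> g x \<in> Z'" by (auto simp: Z'_def)
      then have "i x = \<pi> x" using i(2) j\<pi> \<pi>_inj(2) by (metis image_subset_iff)
      then have "\<beta> (\<rho> g) (i x) = \<pi> (\<alpha> g x)" using \<pi> gx(1) z by simp
      then show "\<sigma> g x = \<alpha> g x" using z j\<pi> by (simp add: \<sigma>_def Y_def)
    qed
  qed
qed

section \<open>Groups generated by labelled copies of one set of elements\<close>

text \<open>This is what remains of the functor once a base point \<open>x0\<close> is fixed:
  \<open>D\<close> will be \<open>L({x0})\<close>, and \<open>e x\<close> its copy at
  \<open>x\<close> under the map sending \<open>x0\<close> to \<open>x\<close>. Conditions (a) and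
  (b) survive as generation by labels and as \<open>transposition\<close>; adjacency has
  disappeared, so one argument covers sets and graphs.\<close>

locale labelled_group = group G for G :: "'g monoid" (structure) +
  fixes X :: "'v set" and H :: "'v set \<Rightarrow> 'g set" and D :: "'d set" and e :: "'v \<Rightarrow> 'd \<Rightarrow> 'g"
  assumes H_generate: "Y \<subseteq> X \<Longrightarrow> H Y = generate G (\<Union>y\<in>Y. e y ` D)"
    and H_X: "H X = carrier G"
    and transposition: "u \<in> X \<Longrightarrow> v \<in> X \<Longrightarrow> u \<noteq> v \<Longrightarrow>
      \<exists>\<beta>\<in>AL_f X G H. \<forall>x\<in>X. \<forall>d\<in>D. \<beta> (e x d) = e (transpose u v x) d"
begin

lemma e_in_H: "y \<in> Y \<Longrightarrow> Y \<subseteq> X \<Longrightarrow> d \<in> D \<Longrightarrow> e y d \<in> H Y"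
  by (auto simp: H_generate intro!: generate.incl)

lemma e_closed: "y \<in> X \<Longrightarrow> d \<in> D \<Longrightarrow> e y d \<in> carrier G"
  using e_in_H[of y X d] by (simp add: H_X)

lemma e_image_closed: "Y \<subseteq> X \<Longrightarrow> (\<Union>y\<in>Y. e y ` D) \<subseteq> carrier G"
  using e_closed by auto

lemma subgroup_H: "Y \<subseteq> X \<Longrightarrow> subgroup (H Y) G"
  using generate_is_subgroup[OF e_image_closed] by (simp add: H_generate)

lemma H_closed: "Y \<subseteq> X \<Longrightarrow> x \<in> H Y \<Longrightarrow> x \<in> carrier G"
  using subgroup.subset[OF subgroup_H] by auto

lemma H_Un:
  assumes "Y \<subseteq> X" "Z \<subseteq> X"
  shows "H (Y \<union> Z) = generate G (H Y \<union> H Z)"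
proof
  have "(\<Union>y\<in>Y \<union> Z. e y ` D) \<subseteq> H Y \<union> H Z" using e_in_H assms by blast
  then show "H (Y \<union> Z) \<subseteq> generate G (H Y \<union> H Z)"
    using mono_generate assms by (simp add: H_generate[of "Y \<union> Z"])
  have "H Y \<subseteq> H (Y \<union> Z)" "H Z \<subseteq> H (Y \<union> Z)"
    using assms mono_generate[of "\<Union>y\<in>Y. e y ` D" "\<Union>y\<in>Y \<union> Z. e y ` D"]
      mono_generate[of "\<Union>y\<in>Z. e y ` D" "\<Union>y\<in>Y \<union> Z. e y ` D"]
    by (auto simp: H_generate)
  then show "generate G (H Y \<union> H Z) \<subseteq> H (Y \<union> Z)"
    using generate_subgroup_incl[OF _ subgroup_H[of "Y \<union> Z"]] assms by simp
qed

lemma hom_auto: "f \<in> auto G \<Longrightarrow> group_hom G G f"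
  by (simp add: auto_def group_hom_def group_hom_axioms_def is_group)

lemma auto_eq_on_H:
  assumes "f \<in> auto G" "h \<in> auto G" "Y \<subseteq> X"
    and "\<And>y d. y \<in> Y \<Longrightarrow> d \<in> D \<Longrightarrow> f (e y d) = h (e y d)" and "x \<in> H Y"
  shows "f x = h x"
  using assms hom_eq_on_generate[OF is_group is_group _ _ e_image_closed[OF assms(3)], of f h x]
  by (auto simp: auto_def H_generate)

text \<open>The labels generate \<open>G\<close>. Every product formula for automorphisms that
  permute labels is thereby reduced to one for the permutations of \<open>X\<close>.\<close>

lemma auto_eq:
  assumes "f \<in> auto G" "h \<in> auto G"
    and "\<And>x d. x \<in> X \<Longrightarrow> d \<in> D \<Longrightarrow> f (e x d) = h (e x d)"
  shows "f = h"
  using auto_eq_on_H[OF assms(1,2) subset_refl] assms by (intro auto_eqI) (auto simp: H_X)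

lemma auto_image_H:
  assumes "f \<in> auto G" "\<And>x d. x \<in> X \<Longrightarrow> d \<in> D \<Longrightarrow> f (e x d) = e (\<sigma> x) d"
    and "Y \<subseteq> X" "\<sigma> ` Y \<subseteq> X"
  shows "f ` H Y = H (\<sigma> ` Y)"
proof -
  interpret f: group_hom G G f by (rule hom_auto[OF assms(1)])
  have "f ` e y ` D = e (\<sigma> y) ` D" if "y \<in> Y" for y
    using assms(2)[of y] assms(3) that by (auto simp: image_image intro!: image_cong)
  then have "f ` (\<Union>y\<in>Y. e y ` D) = (\<Union>y\<in>\<sigma> ` Y. e y ` D)" by (simp add: image_UN)
  then show ?thesis
    using f.generate_img[OF e_image_closed[OF assms(3)]] assms(3,4) by (simp add: H_generate)
qed

section \<open>Supports of automorphisms\<close>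

text \<open>\<open>AL_f\<close> hides its witness \<open>Y\<close> behind an existential; naming it
  allows supports to be enlarged, shared and moved.\<close>

definition supported :: "('g \<Rightarrow> 'g) \<Rightarrow> 'v set \<Rightarrow> bool" where
  "supported \<beta> Y \<longleftrightarrow> \<beta> \<in> auto G \<and> Y \<subseteq> X \<and> \<beta> ` H Y = H Y \<and> (\<forall>x\<in>H (X - Y). \<beta> x = x)"

lemma AL_f_iff: "\<beta> \<in> AL_f X G H \<longleftrightarrow> (\<exists>Y. finite Y \<and> supported \<beta> Y)"
  by (auto simp: AL_f_def supported_def)

lemma AL_f_auto: "\<beta> \<in> AL_f X G H \<Longrightarrow> \<beta> \<in> auto G"
  by (simp add: AL_f_def)

text \<open>\<open>H Y'\<close> is generated by \<open>H Y\<close>, which \<beta> preserves, and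
  \<open>H (Y' - Y)\<close>, which \<beta> fixes pointwise because it lies in
  \<open>H (X - Y)\<close>. Thus finitely many elements of \<open>AL_f\<close> have a common finite
  support.\<close>

lemma supported_mono:
  assumes "supported \<beta> Y" "Y \<subseteq> Y'" "Y' \<subseteq> X"
  shows "supported \<beta> Y'"
proof -
  have \<beta>: "\<beta> \<in> auto G" "\<beta> ` H Y = H Y" "\<And>x. x \<in> H (X - Y) \<Longrightarrow> \<beta> x = x"
    using assms(1) by (auto simp: supported_def)
  interpret \<beta>: group_hom G G \<beta> by (rule hom_auto[OF \<beta>(1)])
  have "X - Y = (Y' - Y) \<union> (X - Y')" using assms by auto
  then have "H (X - Y) = generate G (H (Y' - Y) \<union> H (X - Y'))"
    using H_Un[of "Y' - Y" "X - Y'"] assms by auto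
  then have fixed: "\<beta> x = x" if "x \<in> H (Y' - Y) \<union> H (X - Y')" for x
    using \<beta>(3)[of x] generate.incl[OF that, of G] by simp
  have "Y' = Y \<union> (Y' - Y)" using assms by auto
  then have gen: "H Y' = generate G (H Y \<union> H (Y' - Y))"
    using H_Un[of Y "Y' - Y"] assms by auto
  have "\<beta> ` H (Y' - Y) = H (Y' - Y)" 
    using image_cong[OF refl, of "H (Y' - Y)" \<beta> "\<lambda>x. x"] fixed by simp
  moreover have "H Y \<union> H (Y' - Y) \<subseteq> carrier G" using H_closed assms by blast
  ultimately have "\<beta> ` H Y' = H Y'"
    using \<beta>.generate_img[of "H Y \<union> H (Y' - Y)"] \<beta>(2) by (simp add: gen image_Un)
  then show ?thesis using \<beta>(1) assms(3) fixed by (simp add: supported_def)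
qed

lemma common_support:
  assumes "finite A" "A \<subseteq> AL_f X G H"
  obtains Y where "finite Y" "Y \<subseteq> X" "\<forall>\<beta>\<in>A. supported \<beta> Y"
proof -
  have "\<forall>\<beta>\<in>A. \<exists>Y. finite Y \<and> supported \<beta> Y" using assms(2) AL_f_iff by blast
  then obtain S where S: "\<And>\<beta>. \<beta> \<in> A \<Longrightarrow> finite (S \<beta>) \<and> supported \<beta> (S \<beta>)" by metis
  then have X: "(\<Union>\<beta>\<in>A. S \<beta>) \<subseteq> X" unfolding supported_def by blast
  show ?thesis
  proof (rule that[of "\<Union>\<beta>\<in>A. S \<beta>"])
    show "\<forall>\<beta>\<in>A. supported \<beta> (\<Union>\<beta>\<in>A. S \<beta>)"
    proof
      fix \<beta> assume "\<beta> \<in> A"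
      then show "supported \<beta> (\<Union>\<beta>\<in>A. S \<beta>)"
        using supported_mono[OF _ _ X, of \<beta> "S \<beta>"] S by blast
    qed
  qed (use S assms(1) X in auto)
qed

lemma inv_auto: "f \<in> auto G \<Longrightarrow> inv\<^bsub>AutoGroup G\<^esub> f \<in> auto G"
  using group.inv_closed[OF AutoGroup] by (simp add: carrier_AutoGroup)

lemma mult_auto: "f \<in> auto G \<Longrightarrow> h \<in> auto G \<Longrightarrow> f \<otimes>\<^bsub>AutoGroup G\<^esub> h \<in> auto G"
  using monoid.m_closed[OF group.is_monoid[OF AutoGroup]] by (simp add: carrier_AutoGroup)

lemma supported_mult:
  assumes "supported \<beta> Y" "supported \<gamma> Y"
  shows "supported (\<beta> \<otimes>\<^bsub>AutoGroup G\<^esub> \<gamma>) Y"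
proof -
  have a: "\<beta> \<in> auto G" "\<gamma> \<in> auto G" "Y \<subseteq> X" using assms by (auto simp: supported_def)
  have "(\<beta> \<otimes>\<^bsub>AutoGroup G\<^esub> \<gamma>) x = \<beta> (\<gamma> x)" if "x \<in> carrier G" for x
    using mult_AutoGroup[OF a(1,2) that] .
  moreover from this have "(\<beta> \<otimes>\<^bsub>AutoGroup G\<^esub> \<gamma>) ` H Y = \<beta> ` \<gamma> ` H Y"
    using H_closed[OF a(3)] by (simp add: image_image cong: image_cong)
  moreover have "\<beta> \<otimes>\<^bsub>AutoGroup G\<^esub> \<gamma> \<in> auto G"
    using a mult_auto by blast
  ultimately show ?thesis using assms a H_closed[of "X - Y"] by (simp add: supported_def)
qed

lemma supported_inv:
  assumes "supported \<beta> Y"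
  shows "supported (inv\<^bsub>AutoGroup G\<^esub> \<beta>) Y"
proof -
  have a: "\<beta> \<in> auto G" "Y \<subseteq> X" "\<beta> ` H Y = H Y" using assms by (auto simp: supported_def)
  have inv: "(inv\<^bsub>AutoGroup G\<^esub> \<beta>) (\<beta> x) = x" if "x \<in> carrier G" for x
    using inv_AutoGroup_apply[OF is_group a(1) that] by simp
  have "(inv\<^bsub>AutoGroup G\<^esub> \<beta>) ` \<beta> ` H Y = H Y"
    using inv H_closed[OF a(2)] by (simp add: image_image cong: image_cong)
  moreover have "(inv\<^bsub>AutoGroup G\<^esub> \<beta>) x = x" if "x \<in> H (X - Y)" for x
    using inv[of x] H_closed[of "X - Y" x] that assms by (simp add: supported_def)
  ultimately show ?thesis using a inv_auto by (simp add: supported_def)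
qed

lemma subgroup_AL_f: "subgroup (AL_f X G H) (AutoGroup G)"
proof (rule group.subgroupI[OF AutoGroup])
  show "AL_f X G H \<subseteq> carrier (AutoGroup G)" using AL_f_auto by (auto simp: carrier_AutoGroup)
  have "supported \<one>\<^bsub>AutoGroup G\<^esub> {}"
    using id_in_auto H_generate[of "{}"] H_X generate_empty by (simp add: supported_def one_AutoGroup)
  then show "AL_f X G H \<noteq> {}" using AL_f_iff by blast
  show "inv\<^bsub>AutoGroup G\<^esub> \<beta> \<in> AL_f X G H" if "\<beta> \<in> AL_f X G H" for \<beta>
    using that unfolding AL_f_iff by (meson supported_inv)
  fix \<beta> \<gamma> assume "\<beta> \<in> AL_f X G H" "\<gamma> \<in> AL_f X G H"
  then have "finite {\<beta>, \<gamma>}" "{\<beta>, \<gamma>} \<subseteq> AL_f X G H" by auto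
  then obtain Y where Y: "finite Y" "\<forall>\<delta>\<in>{\<beta>, \<gamma>}. supported \<delta> Y"
    by (rule common_support)
  then have "supported (\<beta> \<otimes>\<^bsub>AutoGroup G\<^esub> \<gamma>) Y" by (intro supported_mult) simp_all
  then show "\<beta> \<otimes>\<^bsub>AutoGroup G\<^esub> \<gamma> \<in> AL_f X G H"
    using Y(1) by (auto simp: AL_f_iff)
qed

lemma conj_apply:
  assumes "a \<in> auto G" "\<beta> \<in> auto G" "z \<in> carrier G"
  shows "(a \<otimes>\<^bsub>AutoGroup G\<^esub> \<beta> \<otimes>\<^bsub>AutoGroup G\<^esub> inv\<^bsub>AutoGroup G\<^esub> a) (a z) = a (\<beta> z)"
  using assms
  by (simp add: mult_AutoGroup mult_auto inv_auto auto_closed inv_AutoGroup_apply[OF is_group])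

text \<open>The conjugate sends \<open>a z\<close> to \<open>a (\<beta> z)\<close>, so a relabelling
  by \<sigma> carries the support along. Bijectivity of \<sigma> on \<open>X\<close> makes it carry
  the complement of \<open>Y\<close> to the complement of the image. As finite sets stay finite,
  \<Gamma> normalises \<open>AL_f(X)\<close>.\<close>

lemma supported_conj:
  assumes "supported \<beta> Y" "a \<in> auto G" "\<And>x d. x \<in> X \<Longrightarrow> d \<in> D \<Longrightarrow> a (e x d) = e (\<sigma> x) d"
    and "bij_betw \<sigma> X X"
  shows "supported (a \<otimes>\<^bsub>AutoGroup G\<^esub> \<beta> \<otimes>\<^bsub>AutoGroup G\<^esub> inv\<^bsub>AutoGroup G\<^esub> a) (\<sigma> ` Y)"
    (is "supported ?c _")
proof -
  have \<beta>: "\<beta> \<in> auto G" "Y \<subseteq> X" "\<beta> ` H Y = H Y" "\<And>x. x \<in> H (X - Y) \<Longrightarrow> \<beta> x = x"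
    using assms(1) by (auto simp: supported_def)
  have \<sigma>: "\<sigma> ` Y \<subseteq> X" "\<sigma> ` (X - Y) = X - \<sigma> ` Y"
    using assms(4) \<beta>(2) inj_on_image_set_diff[of \<sigma> X X Y] image_mono[OF \<beta>(2), of \<sigma>] by (auto simp: bij_betw_def)
  have img: "a ` H Y = H (\<sigma> ` Y)" "a ` H (X - Y) = H (X - \<sigma> ` Y)"
    using auto_image_H[OF assms(2,3) \<beta>(2) \<sigma>(1)] auto_image_H[OF assms(2,3), of "X - Y"] \<sigma>(2) by auto
  have c: "?c (a z) = a (\<beta> z)" if "z \<in> carrier G" for z
    using conj_apply[OF assms(2) \<beta>(1) that] .
  have "?c ` a ` H Y = a ` \<beta> ` H Y"
    using c H_closed[OF \<beta>(2)] by (simp add: image_image cong: image_cong)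
  then have "?c ` H (\<sigma> ` Y) = H (\<sigma> ` Y)" using img(1) \<beta>(3) by simp
  moreover have "?c x = x" if x: "x \<in> H (X - \<sigma> ` Y)" for x
  proof -
    obtain z where "z \<in> H (X - Y)" "x = a z" using x unfolding img(2)[symmetric] by blast
    then show ?thesis using c[of z] \<beta>(4) H_closed[of "X - Y" z] by simp
  qed
  ultimately show ?thesis
    using \<sigma>(1) mult_auto inv_auto assms(2) \<beta>(1) by (simp add: supported_def)
qed

text \<open>Permutations of a finite set are products of transpositions, which the locale realises
  one by one, and \<open>AL_f\<close> is closed under products.\<close>

lemma permutation_in_AL_f:
  assumes "finite Y" "Y \<subseteq> X" "\<sigma> permutes Y"
  shows "\<exists>\<beta>\<in>AL_f X G H. \<forall>x\<in>X. \<forall>d\<in>D. \<beta> (e x d) = e (\<sigma> x) d"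
  using assms(3,1)
proof (induction rule: permutes_induct)
  case id
  have "\<one>\<^bsub>AutoGroup G\<^esub> \<in> AL_f X G H" using subgroup.one_closed[OF subgroup_AL_f] .
  then show ?case by (rule bexI[rotated]) (simp add: one_AutoGroup e_closed)
next
  case (swap u v \<sigma>)
  then obtain \<beta> where \<beta>: "\<beta> \<in> AL_f X G H" "\<forall>x\<in>X. \<forall>d\<in>D. \<beta> (e x d) = e (\<sigma> x) d" by blast
  obtain \<tau> where \<tau>: "\<tau> \<in> AL_f X G H" "\<forall>x\<in>X. \<forall>d\<in>D. \<tau> (e x d) = e (transpose u v x) d"
    using transposition[of u v] swap.hyps assms(2) by blast
  have "\<sigma> x \<in> X" if "x \<in> X" for x
    using permutes_in_image[OF swap.hyps(4), of x] permutes_not_in[OF swap.hyps(4), of x] that assms(2)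
    by (cases "x \<in> Y") auto
  then have "\<forall>x\<in>X. \<forall>d\<in>D. (\<tau> \<otimes>\<^bsub>AutoGroup G\<^esub> \<beta>) (e x d) = e ((transpose u v \<circ> \<sigma>) x) d"
    using \<beta> \<tau> by (simp add: mult_AutoGroup AL_f_auto e_closed)
  then show ?case using subgroup.m_closed[OF subgroup_AL_f \<tau>(1) \<beta>(1)] by blast
qed

text \<open>Both automorphisms fix all labels outside \<open>Y\<close>, and the labels
  generate.\<close>

lemma AL_f_eq_of_eq_on_support:
  assumes "supported \<beta> Y" "supported \<gamma> Y" "\<And>x. x \<in> H Y \<Longrightarrow> \<beta> x = \<gamma> x"
  shows "\<beta> = \<gamma>"
proof (rule auto_eq)
  fix x d assume x: "x \<in> X" "d \<in> D"
  show "\<beta> (e x d) = \<gamma> (e x d)"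
  proof (cases "x \<in> Y")
    case True
    then show ?thesis using assms(3) e_in_H[of x Y d] x assms(1) by (simp add: supported_def)
  next
    case False
    then show ?thesis using e_in_H[of x "X - Y" d] x assms(1,2) by (simp add: supported_def)
  qed
qed (use assms in \<open>simp_all add: supported_def\<close>)

lemma restrict_supported_auto:
  assumes "supported \<beta> Y"
  shows "restrict \<beta> (H Y) \<in> auto (G\<lparr>carrier := H Y\<rparr>)"
proof -
  have \<beta>: "\<beta> \<in> hom G G" "inj_on \<beta> (carrier G)" "Y \<subseteq> X" "\<beta> ` H Y = H Y"
    using assms by (auto simp: supported_def auto_def Bij_def bij_betw_def)
  have "inj_on \<beta> (H Y)" using \<beta>(2) H_closed[OF \<beta>(3)] by (auto intro: inj_on_subset)
  moreover have "restrict \<beta> (H Y) \<in> hom (G\<lparr>carrier := H Y\<rparr>) (G\<lparr>carrier := H Y\<rparr>)"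
  proof (rule homI)
    fix x y assume "x \<in> carrier (G\<lparr>carrier := H Y\<rparr>)" "y \<in> carrier (G\<lparr>carrier := H Y\<rparr>)"
    then show "restrict \<beta> (H Y) (x \<otimes>\<^bsub>G\<lparr>carrier := H Y\<rparr>\<^esub> y)
        = restrict \<beta> (H Y) x \<otimes>\<^bsub>G\<lparr>carrier := H Y\<rparr>\<^esub> restrict \<beta> (H Y) y"
      using \<beta>(1) H_closed[OF \<beta>(3)] subgroup.m_closed[OF subgroup_H[OF \<beta>(3)]] by (simp add: hom_mult)
  qed (use \<beta>(4) in auto)
  ultimately show ?thesis using \<beta>(4) by (simp add: auto_def Bij_def bij_betw_def)
qed

section \<open>Local embeddings of \<open>AL_f(X)\<close> and of the enrichment\<close>

text \<open>A finite \<open>A\<close> has one finite common support \<open>Y\<close>, and on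
  automorphisms supported there restriction to \<open>H Y\<close> is injective and multiplicative.
  The hypotheses make the automorphism group of \<open>H Y\<close> separated by finite quotients,
  hence LEF.\<close>

lemma LEF_AL_f_group:
  assumes "\<And>Y. finite Y \<Longrightarrow> Y \<subseteq> X \<Longrightarrow> finitely_generated_group (G\<lparr>carrier := H Y\<rparr>)"
    and "\<And>Y. finite Y \<Longrightarrow> Y \<subseteq> X \<Longrightarrow> homs_to_finite_separate (G\<lparr>carrier := H Y\<rparr>)"
  shows "LEF_group (AL_f_group X G H)"
proof (rule LEF_groupI)
  show "group (AL_f_group X G H)"
    using group.subgroup_imp_group[OF AutoGroup subgroup_AL_f] by (simp add: AL_f_group_def)
  fix A assume "finite A" "A \<subseteq> carrier (AL_f_group X G H)"
  then have "finite A" "A \<subseteq> AL_f X G H" by (simp_all add: AL_f_group_def)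
  then obtain Y where Y: "finite Y" "Y \<subseteq> X" "\<forall>\<beta>\<in>A. supported \<beta> Y"
    by (rule common_support)
  let ?M = "G\<lparr>carrier := H Y\<rparr>" and ?\<phi> = "\<lambda>\<beta>. restrict \<beta> (H Y)"
  have \<phi>: "?\<phi> \<in> A \<rightarrow> carrier (AutoGroup ?M)"
    using restrict_supported_auto Y(3) by (auto simp: carrier_AutoGroup)
  have M: "group ?M" using subgroup_imp_group[OF subgroup_H[OF Y(2)]] .
  have "LEF_group (AutoGroup ?M)"
    using assms[OF Y(1,2)] homs_to_finite_separate_AutoGroup group.AutoGroup[OF M]
      LEF_group_if_homs_to_finite_separate by blast
  moreover have "inj_on ?\<phi> A"
  proof (rule inj_onI)
    fix \<beta> \<gamma> assume *: "\<beta> \<in> A" "\<gamma> \<in> A" "?\<phi> \<beta> = ?\<phi> \<gamma>"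
    have "\<beta> x = \<gamma> x" if "x \<in> H Y" for x using fun_cong[OF *(3), of x] that by simp
    then show "\<beta> = \<gamma>" using AL_f_eq_of_eq_on_support[of \<beta> Y \<gamma>] Y(3) * by blast
  qed
  moreover have "?\<phi> (\<beta> \<otimes>\<^bsub>AL_f_group X G H\<^esub> \<gamma>) = ?\<phi> \<beta> \<otimes>\<^bsub>AutoGroup ?M\<^esub> ?\<phi> \<gamma>"
    if "\<beta> \<in> A" "\<gamma> \<in> A" for \<beta> \<gamma>
  proof
    fix x
    have s: "supported \<beta> Y" "supported \<gamma> Y" "\<beta> \<in> auto G" "\<gamma> \<in> auto G"
      using Y(3) that by (auto simp: supported_def)
    note r = restrict_supported_auto[OF s(1)] restrict_supported_auto[OF s(2)]
    show "?\<phi> (\<beta> \<otimes>\<^bsub>AL_f_group X G H\<^esub> \<gamma>) x = (?\<phi> \<beta> \<otimes>\<^bsub>AutoGroup ?M\<^esub> ?\<phi> \<gamma>) x"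
    proof (cases "x \<in> H Y")
      case True
      then have "\<gamma> x \<in> H Y" using s(2) by (auto simp: supported_def)
      then show ?thesis
        using True mult_AutoGroup[OF r, of x] mult_AutoGroup[OF s(3,4) H_closed[OF Y(2) True]]
        by (simp add: AL_f_group_def)
    next
      case False
      have "?\<phi> \<beta> \<otimes>\<^bsub>AutoGroup ?M\<^esub> ?\<phi> \<gamma> \<in> auto ?M"
        using monoid.m_closed[OF group.is_monoid[OF group.AutoGroup[OF M]]] r
        by (simp add: carrier_AutoGroup)
      then show ?thesis using False by (simp add: auto_def Bij_def extensional_def)
    qed
  qed
  ultimately show "\<exists>(K :: ('g \<Rightarrow> 'g) monoid) \<phi>. LEF_group K \<and> \<phi> \<in> A \<rightarrow> carrier K \<and> inj_on \<phi> A \<and>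
      (\<forall>g\<in>A. \<forall>h\<in>A. g \<otimes>\<^bsub>AL_f_group X G H\<^esub> h \<in> A \<longrightarrow>
        \<phi> (g \<otimes>\<^bsub>AL_f_group X G H\<^esub> h) = \<phi> g \<otimes>\<^bsub>K\<^esub> \<phi> h)"
    using \<phi> by blast
qed

text \<open>A conjugate of \<beta> depends on the conjugating relabelling only through the support
  \<open>Z\<close>: both sides are supported on the common image of \<open>Z\<close>, and there both
  send \<open>a z = t z\<close> to \<open>a (\<beta> z) = t (\<beta> z)\<close>. This lets an
  element \<open>t\<close> of \<open>AL_f(X)\<close> stand in for \<open>a\<close>, which may move
  infinitely many labels.\<close>

lemma conj_eq_of_agree_on_support:
  assumes "supported \<beta> Z" "a \<in> auto G" "t \<in> auto G"
    and "\<And>x d. x \<in> X \<Longrightarrow> d \<in> D \<Longrightarrow> a (e x d) = e (\<alpha> x) d" "bij_betw \<alpha> X X"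
    and "\<And>x d. x \<in> X \<Longrightarrow> d \<in> D \<Longrightarrow> t (e x d) = e (\<sigma> x) d" "bij_betw \<sigma> X X"
    and "\<And>x. x \<in> Z \<Longrightarrow> \<sigma> x = \<alpha> x"
  shows "a \<otimes>\<^bsub>AutoGroup G\<^esub> \<beta> \<otimes>\<^bsub>AutoGroup G\<^esub> inv\<^bsub>AutoGroup G\<^esub> a =
    t \<otimes>\<^bsub>AutoGroup G\<^esub> \<beta> \<otimes>\<^bsub>AutoGroup G\<^esub> inv\<^bsub>AutoGroup G\<^esub> t"
proof -
  have Z: "Z \<subseteq> X" "\<beta> ` H Z = H Z" "\<beta> \<in> auto G" using assms(1) by (auto simp: supported_def)
  have at: "a z = t z" if "z \<in> H Z" for z
    using auto_eq_on_H[OF assms(2,3) Z(1) _ that] assms(4,6,8) Z(1) by (metis subsetD)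
  have img: "\<sigma> ` Z = \<alpha> ` Z" using assms(8) by (rule image_cong[OF refl])
  have \<alpha>Z: "a ` H Z = H (\<alpha> ` Z)"
    using assms(5) Z(1) by (intro auto_image_H[OF assms(2,4)]) (auto simp: bij_betw_def)
  show ?thesis
  proof (rule AL_f_eq_of_eq_on_support)
    show "supported (a \<otimes>\<^bsub>AutoGroup G\<^esub> \<beta> \<otimes>\<^bsub>AutoGroup G\<^esub> inv\<^bsub>AutoGroup G\<^esub> a) (\<alpha> ` Z)"
      by (rule supported_conj[OF assms(1,2,4,5)])
    show "supported (t \<otimes>\<^bsub>AutoGroup G\<^esub> \<beta> \<otimes>\<^bsub>AutoGroup G\<^esub> inv\<^bsub>AutoGroup G\<^esub> t) (\<alpha> ` Z)"
      using supported_conj[OF assms(1,3,6,7)] img by simp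
    fix x assume "x \<in> H (\<alpha> ` Z)"
    then obtain z where z: "z \<in> H Z" "x = a z" using \<alpha>Z by auto
    then have "z \<in> carrier G" "x = t z" "a (\<beta> z) = t (\<beta> z)"
      using H_closed[OF Z(1)] at Z(2) by auto
    then show "(a \<otimes>\<^bsub>AutoGroup G\<^esub> \<beta> \<otimes>\<^bsub>AutoGroup G\<^esub> inv\<^bsub>AutoGroup G\<^esub> a) x =
        (t \<otimes>\<^bsub>AutoGroup G\<^esub> \<beta> \<otimes>\<^bsub>AutoGroup G\<^esub> inv\<^bsub>AutoGroup G\<^esub> t) x"
      using conj_apply[OF assms(2) Z(3)] conj_apply[OF assms(3) Z(3)] z by metis
  qed
qed

lemma LEF_enrichment:
  fixes \<Gamma> :: "'a monoid"
  assumes LEF: "LEF_group \<Gamma>" "LEF_action \<Gamma> X \<alpha>" "LEF_group (AL_f_group X G H)"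
    and a: "\<And>g. g \<in> carrier \<Gamma> \<Longrightarrow> a g \<in> auto G"
      "\<And>g x d. g \<in> carrier \<Gamma> \<Longrightarrow> x \<in> X \<Longrightarrow> d \<in> D \<Longrightarrow> a g (e x d) = e (\<alpha> g x) d"
  shows "LEF_group (enrichment \<Gamma> X G H a)"
proof -
  interpret \<alpha>: group_action \<Gamma> X \<alpha> using LEF(2) by (simp add: LEF_action_def)
  have \<Gamma>: "group \<Gamma>" using LEF(1) by (simp add: LEF_group_def)
  have bij: "bij_betw (\<alpha> g) X X" if "g \<in> carrier \<Gamma>" for g
    using \<alpha>.bij_prop0[OF that] by (simp add: Bij_def)
  show ?thesis
    unfolding enrichment_def AL_f_group_def
  proof (rule LEF_group_semidirect_locally_inner[OF AutoGroup subgroup_AL_f])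
    show "a \<in> hom \<Gamma> (AutoGroup G)"
    proof (rule homI)
      fix g h assume gh: "g \<in> carrier \<Gamma>" "h \<in> carrier \<Gamma>"
      have ghc: "g \<otimes>\<^bsub>\<Gamma>\<^esub> h \<in> carrier \<Gamma>" using monoid.m_closed[OF group.is_monoid[OF \<Gamma>] gh] .
      show "a (g \<otimes>\<^bsub>\<Gamma>\<^esub> h) = a g \<otimes>\<^bsub>AutoGroup G\<^esub> a h"
      proof (rule auto_eq)
        fix x d assume x: "x \<in> X" "d \<in> D"
        then show "a (g \<otimes>\<^bsub>\<Gamma>\<^esub> h) (e x d) = (a g \<otimes>\<^bsub>AutoGroup G\<^esub> a h) (e x d)"
          using gh ghc \<alpha>.composition_rule[OF x(1) gh] \<alpha>.element_image[OF gh(2) x(1)]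
          by (simp add: mult_AutoGroup a e_closed)
      qed (use a(1) gh ghc mult_auto in auto)
    qed (simp add: carrier_AutoGroup a)
  next
    fix g \<beta> assume g: "g \<in> carrier \<Gamma>" and "\<beta> \<in> AL_f X G H"
    then obtain Y where "finite Y" "supported \<beta> Y" using AL_f_iff by blast
    then show "a g \<otimes>\<^bsub>AutoGroup G\<^esub> \<beta> \<otimes>\<^bsub>AutoGroup G\<^esub> inv\<^bsub>AutoGroup G\<^esub> (a g) \<in> AL_f X G H"
      using supported_conj[OF _ a(1)[OF g] a(2)[OF g] bij[OF g]] unfolding AL_f_iff by (meson finite_imageI)
  next
    show "LEF_group (AutoGroup G\<lparr>carrier := AL_f X G H\<rparr>)" using LEF(3) by (simp add: AL_f_group_def)
  next
    fix F B assume F: "finite F" "F \<subseteq> carrier \<Gamma>" and B: "finite B" "B \<subseteq> AL_f X G H"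
    \<comment> \<open>Since all of \<open>B\<close> is supported on one finite \<open>Z\<close>, it
      is enough for the permutations \<open>\<sigma> g\<close> to imitate \<open>\<alpha> g\<close>
      on \<open>Z\<close>.\<close>
    obtain Z where Z: "finite Z" "Z \<subseteq> X" "\<forall>\<beta>\<in>B. supported \<beta> Z"
      using common_support[OF B] .
    obtain Y \<sigma> where Y: "finite Y" "Y \<subseteq> X" and \<sigma>: "\<And>g. g \<in> F \<Longrightarrow> \<sigma> g permutes Y"
      and mult: "\<And>g h. g \<in> F \<Longrightarrow> h \<in> F \<Longrightarrow> g \<otimes>\<^bsub>\<Gamma>\<^esub> h \<in> F \<Longrightarrow> \<sigma> (g \<otimes>\<^bsub>\<Gamma>\<^esub> h) = \<sigma> g \<circ> \<sigma> h"
      and agree: "\<And>g x. g \<in> F \<Longrightarrow> x \<in> Z \<Longrightarrow> \<sigma> g x = \<alpha> g x"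
      using LEF_action_local_permutations[OF LEF(2) F Z(1,2)] by metis
    have \<sigma>X: "bij_betw (\<sigma> g) X X" if "g \<in> F" for g
      using permutes_imp_bij[OF permutes_subset[OF \<sigma>[OF that] Y(2)]] .
    have "\<forall>g\<in>F. \<exists>\<beta>. \<beta> \<in> AL_f X G H \<and> (\<forall>x\<in>X. \<forall>d\<in>D. \<beta> (e x d) = e (\<sigma> g x) d)"
      using permutation_in_AL_f[OF Y \<sigma>] by blast
    then obtain t where t: "\<forall>g\<in>F. t g \<in> AL_f X G H \<and> (\<forall>x\<in>X. \<forall>d\<in>D. t g (e x d) = e (\<sigma> g x) d)"
      by (rule bchoice[THEN exE])
    \<comment> \<open>The \<open>t g\<close> were chosen independently of each other, but each is
      determined by \<open>\<sigma> g\<close>, so the multiplicativity of \<sigma> passes to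
      them.\<close>
    have "t (g \<otimes>\<^bsub>\<Gamma>\<^esub> h) = t g \<otimes>\<^bsub>AutoGroup G\<^esub> t h" if gh: "g \<in> F" "h \<in> F" "g \<otimes>\<^bsub>\<Gamma>\<^esub> h \<in> F" for g h
    proof (rule auto_eq)
      show "t (g \<otimes>\<^bsub>\<Gamma>\<^esub> h) (e x d) = (t g \<otimes>\<^bsub>AutoGroup G\<^esub> t h) (e x d)" if "x \<in> X" "d \<in> D" for x d
        using that gh t bij_betwE[OF \<sigma>X[OF gh(2)]] mult[OF gh]
        by (simp add: mult_AutoGroup AL_f_auto e_closed)
    qed (use t gh AL_f_auto mult_auto in auto)
    moreover have "a g \<otimes>\<^bsub>AutoGroup G\<^esub> \<beta> \<otimes>\<^bsub>AutoGroup G\<^esub> inv\<^bsub>AutoGroup G\<^esub> (a g) =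
        t g \<otimes>\<^bsub>AutoGroup G\<^esub> \<beta> \<otimes>\<^bsub>AutoGroup G\<^esub> inv\<^bsub>AutoGroup G\<^esub> (t g)" if g: "g \<in> F" and "\<beta> \<in> B" for g \<beta>
    proof (rule conj_eq_of_agree_on_support[OF bspec[OF Z(3) that(2)]])
      have gc: "g \<in> carrier \<Gamma>" using g F(2) by auto
      show "a g \<in> auto G" "bij_betw (\<alpha> g) X X" using a(1) bij gc by auto
      show "a g (e x d) = e (\<alpha> g x) d" if "x \<in> X" "d \<in> D" for x d using a(2) gc that by simp
      show "t g \<in> auto G" using t g AL_f_auto by auto
      show "t g (e x d) = e (\<sigma> g x) d" if "x \<in> X" "d \<in> D" for x d using t g that by simp
    qed (use agree g \<sigma>X in auto)
    ultimately show "\<exists>t\<in>F \<rightarrow> AL_f X G H.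
        (\<forall>g\<in>F. \<forall>h\<in>F. g \<otimes>\<^bsub>\<Gamma>\<^esub> h \<in> F \<longrightarrow> t (g \<otimes>\<^bsub>\<Gamma>\<^esub> h) = t g \<otimes>\<^bsub>AutoGroup G\<^esub> t h) \<and>
        (\<forall>g\<in>F. \<forall>\<beta>\<in>B. a g \<otimes>\<^bsub>AutoGroup G\<^esub> \<beta> \<otimes>\<^bsub>AutoGroup G\<^esub> inv\<^bsub>AutoGroup G\<^esub> (a g) =
          t g \<otimes>\<^bsub>AutoGroup G\<^esub> \<beta> \<otimes>\<^bsub>AutoGroup G\<^esub> inv\<^bsub>AutoGroup G\<^esub> (t g))"
      using t by (intro bexI[of _ t]) auto
  qed (fact LEF(1))
qed

end

section \<open>Haloes over sets and graphs\<close>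

text \<open>Instances: \<open>set_family\<close> for \<open>ind = (\<lambda>_ Y. Y)\<close> and
  \<open>graph_family\<close> for \<open>ind = induced\<close>.\<close>

definition family ::
  "('o \<Rightarrow> 'v set \<Rightarrow> 'o) \<Rightarrow> ('o \<Rightarrow> 'g monoid) \<Rightarrow> ('o \<Rightarrow> 'o \<Rightarrow> ('v \<Rightarrow> 'v) \<Rightarrow> 'g \<Rightarrow> 'g) \<Rightarrow>
   'o \<Rightarrow> 'v set \<Rightarrow> 'g set" where
  "family ind L hat Z Y = hat (ind Z Y) Z id ` carrier (L (ind Z Y))"

text \<open>Besides identities and composition, three kinds of morphism drive the argument:
  inclusions, maps out of a single point, and the swap of a two-point object. All of them exist for
  graphs as well as for sets.\<close>

locale halo_functor =
  fixes Obj :: "'o \<Rightarrow> bool" and pts :: "'o \<Rightarrow> 'v set" and Mor :: "'o \<Rightarrow> 'o \<Rightarrow> ('v \<Rightarrow> 'v) \<Rightarrow> bool"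
    and ind :: "'o \<Rightarrow> 'v set \<Rightarrow> 'o"
    and L :: "'o \<Rightarrow> 'g monoid" and hat :: "'o \<Rightarrow> 'o \<Rightarrow> ('v \<Rightarrow> 'v) \<Rightarrow> 'g \<Rightarrow> 'g"
  assumes mono_functor: "mono_functor Obj pts Mor L hat"
    and Obj_ind: "Obj Z \<Longrightarrow> Y \<subseteq> pts Z \<Longrightarrow> Obj (ind Z Y)"
    and pts_ind: "Obj Z \<Longrightarrow> Y \<subseteq> pts Z \<Longrightarrow> pts (ind Z Y) = Y"
    and ind_ind: "V \<subseteq> Y \<Longrightarrow> ind (ind Z Y) V = ind Z V"
    and Mor_id: "Obj Z \<Longrightarrow> Mor Z Z id"
    and Mor_comp: "Mor Z W f \<Longrightarrow> Mor W W' f' \<Longrightarrow> Mor Z W' (f' \<circ> f)"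
    and Mor_ind: "Obj Z \<Longrightarrow> Y \<subseteq> pts Z \<Longrightarrow> Mor (ind Z Y) Z id"
    and Mor_const: "Obj Z \<Longrightarrow> Obj W \<Longrightarrow> u \<in> pts Z \<Longrightarrow> v \<in> pts W \<Longrightarrow> Mor (ind Z {u}) W (\<lambda>_. v)"
    and Mor_transpose: "Obj Z \<Longrightarrow> u \<in> pts Z \<Longrightarrow> v \<in> pts Z \<Longrightarrow>
      Mor (ind Z {u, v}) (ind Z {u, v}) (transpose u v)"
    and halo: "Obj Z \<Longrightarrow> halo (pts Z) (L Z) (family ind L hat Z)"
    and condition_a: "Obj Z \<Longrightarrow> condition_a (pts Z) (L Z) (family ind L hat Z)"
    and condition_b: "Obj Z \<Longrightarrow> condition_b (pts Z) (L Z) (family ind L hat Z)"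
begin

abbreviation "fam \<equiv> family ind L hat"

lemma group_L: "Obj Z \<Longrightarrow> group (L Z)"
  using mono_functor by (simp add: mono_functor_def)

lemma hat_mon: "Obj W \<Longrightarrow> Obj Z \<Longrightarrow> Mor W Z f \<Longrightarrow> hat W Z f \<in> mon (L W) (L Z)"
  using mono_functor by (simp add: mono_functor_def)

lemma hat_hom: "Obj W \<Longrightarrow> Obj Z \<Longrightarrow> Mor W Z f \<Longrightarrow> hat W Z f \<in> hom (L W) (L Z)"
  using hat_mon by (simp add: mon_def)

lemma hat_inj: "Obj W \<Longrightarrow> Obj Z \<Longrightarrow> Mor W Z f \<Longrightarrow> inj_on (hat W Z f) (carrier (L W))"
  using hat_mon by (simp add: mon_def)

lemma hat_closed:
  "Obj W \<Longrightarrow> Obj Z \<Longrightarrow> Mor W Z f \<Longrightarrow> a \<in> carrier (L W) \<Longrightarrow> hat W Z f a \<in> carrier (L Z)"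
  using hat_hom hom_in_carrier by metis

lemma hat_id: "Obj Z \<Longrightarrow> a \<in> carrier (L Z) \<Longrightarrow> hat Z Z id a = a"
  using mono_functor by (simp add: mono_functor_def)

text \<open>Maps that agree on \<open>pts W\<close> represent the same morphism, so \<open>k\<close>
  can be any convenient form of the composite, such as \<open>id\<close> or a constant map.\<close>

lemma hat_comp:
  assumes "Obj W" "Obj Y" "Obj Z" "Mor W Y f" "Mor Y Z f'" "Mor W Z k"
    and "\<And>x. x \<in> pts W \<Longrightarrow> k x = f' (f x)" and "a \<in> carrier (L W)"
  shows "hat Y Z f' (hat W Y f a) = hat W Z k a"
proof -
  have "hat W Z (f' \<circ> f) a = hat Y Z f' (hat W Y f a)"
    using mono_functor assms(1-5,8) unfolding mono_functor_def by blast
  moreover have "\<forall>x\<in>pts W. k x = (f' \<circ> f) x" using assms(7) by simp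
  then have "hat W Z k a = hat W Z (f' \<circ> f) a"
    using mono_functor assms(1,3,6,8) Mor_comp[OF assms(4,5)] unfolding mono_functor_def by blast
  ultimately show ?thesis by simp
qed

lemma fam_subset: "Obj Z \<Longrightarrow> Y \<subseteq> pts Z \<Longrightarrow> fam Z Y \<subseteq> carrier (L Z)"
  using hat_closed Obj_ind Mor_ind by (auto simp: family_def)

text \<open>Halo axiom (ii) reduces the claim to finite subsets, and condition (a) splits off their
  points one at a time.\<close>

lemma carrier_L_generate:
  assumes Z: "Obj Z"
  shows "carrier (L Z) = generate (L Z) (\<Union>z\<in>pts Z. fam Z {z})" (is "_ = generate _ ?S")
proof
  interpret group "L Z" by (rule group_L[OF Z])
  have S: "?S \<subseteq> carrier (L Z)" using fam_subset[OF Z] by blast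
  have sub: "subgroup (generate (L Z) ?S) (L Z)" by (rule generate_is_subgroup[OF S])
  then show "generate (L Z) ?S \<subseteq> carrier (L Z)" by (rule subgroup.subset)
  have fin: "fam Z F \<subseteq> generate (L Z) ?S" if "finite F" "F \<subseteq> pts Z" for F
    using that
  proof (induction F)
    case empty
    then show ?case using halo[OF Z] subgroup.one_closed[OF sub] by (simp add: halo_def)
  next
    case (insert z F)
    have "fam Z (insert z F) = generate (L Z) (fam Z {z} \<union> fam Z F)"
      using condition_a[OF Z] insert.prems unfolding condition_a_def
      by (metis insert_is_Un insert_subset empty_subsetI)
    moreover have "fam Z {z} \<subseteq> generate (L Z) ?S"
      using insert.prems by (auto intro: generate.incl)
    ultimately show ?case using insert generate_subgroup_incl[OF _ sub] by simp
  qed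
  have "carrier (L Z) = generate (L Z) (\<Union>{fam Z F | F. F \<subseteq> pts Z \<and> finite F})"
    using halo[OF Z] by (simp add: halo_def)
  also have "\<dots> \<subseteq> generate (L Z) ?S"
    using fin by (intro generate_subgroup_incl[OF _ sub]) auto
  finally show "carrier (L Z) \<subseteq> generate (L Z) ?S" .
qed

text \<open>For infinite \<open>Y\<close>, axiom (ii) over \<open>X\<close> gives no generators of
  \<open>fam X Y\<close>. It is applied instead over the object \<open>ind X Y\<close>, and the
  inclusion pushes the one-point generators forward to \<open>L X\<close>.\<close>

lemma fam_generate:
  assumes X: "Obj X" and Y: "Y \<subseteq> pts X"
  shows "fam X Y = generate (L X) (\<Union>y\<in>Y. fam X {y})"
proof -
  define W where "W = ind X Y"
  have W: "Obj W" "pts W = Y" "Mor W X id"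
    using Obj_ind pts_ind Mor_ind X Y by (simp_all add: W_def)
  interpret i: group_hom "L W" "L X" "hat W X id"
    using hat_hom W X group_L by (simp add: group_hom_def group_hom_axioms_def)
  have "hat W X id ` fam W {y} = fam X {y}" if "y \<in> Y" for y
  proof -
    have y: "ind W {y} = ind X {y}" using ind_ind that by (simp add: W_def)
    have O: "Obj (ind X {y})" using Obj_ind[OF X, of "{y}"] Y that by auto
    have M: "Mor (ind X {y}) X id" "Mor (ind X {y}) W id"
      using Mor_ind[OF X, of "{y}"] Mor_ind[OF W(1), of "{y}"] W(2) Y y that by auto
    have "hat W X id (hat (ind X {y}) W id a) = hat (ind X {y}) X id a"
      if "a \<in> carrier (L (ind X {y}))" for a
      by (rule hat_comp[OF O W(1) X M(2) W(3) M(1) _ that]) simp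
    then show ?thesis by (simp add: family_def y image_image cong: image_cong)
  qed
  then have "hat W X id ` (\<Union>y\<in>Y. fam W {y}) = (\<Union>y\<in>Y. fam X {y})"
    by (simp add: image_UN)
  moreover have "fam X Y = hat W X id ` generate (L W) (\<Union>y\<in>Y. fam W {y})"
    using carrier_L_generate[OF W(1)] W(2) by (simp add: family_def W_def)
  moreover have "(\<Union>y\<in>Y. fam W {y}) \<subseteq> carrier (L W)"
    using fam_subset[OF W(1)] W(2) by blast
  ultimately show ?thesis using i.generate_img by metis
qed

section \<open>Labels and transpositions\<close>

text \<open>The isomorphism from \<open>L({x0})\<close> to \<open>L({x})\<close> followed by the
  inclusion in \<open>L(X)\<close>, obtained in one stroke from the constant map.\<close>

definition label :: "'o \<Rightarrow> 'v \<Rightarrow> 'v \<Rightarrow> 'g \<Rightarrow> 'g" where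
  "label X x0 x = hat (ind X {x0}) X (\<lambda>_. x)"

lemma label_closed:
  assumes "Obj X" "x0 \<in> pts X" "x \<in> pts X" "d \<in> carrier (L (ind X {x0}))"
  shows "label X x0 x d \<in> carrier (L X)"
  unfolding label_def using assms Obj_ind[of X "{x0}"] Mor_const[of X X] by (intro hat_closed) auto

text \<open>The constant maps between the one-point objects at \<open>x0\<close> and
  \<open>x\<close> are mutually inverse, so by functoriality their groups are isomorphic.\<close>

lemma label_image:
  assumes X: "Obj X" and x: "x0 \<in> pts X" "x \<in> pts X"
  shows "label X x0 x ` carrier (L (ind X {x0})) = fam X {x}"
proof -
  let ?A = "ind X {x0}" and ?B = "ind X {x}"
  have O: "Obj ?A" "Obj ?B" using Obj_ind X x by auto
  have p: "pts ?A = {x0}" "pts ?B = {x}" using pts_ind X x by auto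
  have M: "Mor ?A ?B (\<lambda>_. x)" "Mor ?B ?A (\<lambda>_. x0)" "Mor ?B X id" "Mor ?A X (\<lambda>_. x)"
    using Mor_const[OF X O(2)] Mor_const[OF X O(1)] Mor_ind[OF X, of "{x}"] Mor_const[OF X X] x p by auto
  have split: "hat ?B X id (hat ?A ?B (\<lambda>_. x) d) = label X x0 x d" if "d \<in> carrier (L ?A)" for d
    unfolding label_def by (rule hat_comp[OF O X M(1,3,4) _ that]) simp
  have inverse: "hat ?A ?B (\<lambda>_. x) (hat ?B ?A (\<lambda>_. x0) b) = b" if "b \<in> carrier (L ?B)" for b
    using hat_comp[OF O(2) O(1) O(2) M(2) M(1) Mor_id[OF O(2)] _ that] hat_id[OF O(2) that] p by simp
  have "hat ?A ?B (\<lambda>_. x) ` carrier (L ?A) = carrier (L ?B)"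
  proof
    show "carrier (L ?B) \<subseteq> hat ?A ?B (\<lambda>_. x) ` carrier (L ?A)"
    proof
      fix b assume b: "b \<in> carrier (L ?B)"
      show "b \<in> hat ?A ?B (\<lambda>_. x) ` carrier (L ?A)"
        by (rule image_eqI[where x = "hat ?B ?A (\<lambda>_. x0) b"])
          (simp_all add: inverse[OF b] hat_closed[OF O(2,1) M(2) b])
    qed
  qed (use hat_closed[OF O M(1)] in auto)
  then have "fam X {x} = hat ?B X id ` hat ?A ?B (\<lambda>_. x) ` carrier (L ?A)"
    by (simp add: family_def)
  then show ?thesis using split by (simp add: image_image cong: image_cong)
qed

text \<open>Any two vertices are exchanged by an automorphism of the graph they induce, adjacent or not,
  so condition (b) turns an arbitrary transposition of the vertex set into an automorphism of
  \<open>L(X)\<close>, although it need not be an automorphism of the graph \<open>X\<close>.\<close>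

lemma transposition_in_AL_f:
  assumes X: "Obj X" and x0: "x0 \<in> pts X" and uv: "u \<in> pts X" "v \<in> pts X"
  shows "\<exists>\<beta>\<in>AL_f (pts X) (L X) (fam X). \<forall>x\<in>pts X. \<forall>d\<in>carrier (L (ind X {x0})).
    \<beta> (label X x0 x d) = label X x0 (transpose u v x) d"
proof -
  interpret group "L X" by (rule group_L[OF X])
  define W where "W = ind X {u, v}"
  define i where "i = hat W X id"
  define \<tau> where "\<tau> = hat W W (transpose u v)"
  let ?A = "ind X {x0}" and ?M = "L X\<lparr>carrier := fam X {u, v}\<rparr>"
  have W: "Obj W" "pts W = {u, v}" "Mor W X id" "Mor W W (transpose u v)" and A: "Obj ?A" "pts ?A = {x0}"
    using Obj_ind[OF X] pts_ind[OF X] Mor_ind[OF X] Mor_transpose[OF X] uv x0 by (simp_all add: W_def)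
  have i: "i \<in> hom (L W) (L X)" "inj_on i (carrier (L W))" "i ` carrier (L W) = fam X {u, v}"
    using hat_hom[OF W(1) X W(3)] hat_inj[OF W(1) X W(3)] by (simp_all add: i_def family_def W_def)
  have \<tau>: "\<tau> \<in> hom (L W) (L W)" using hat_hom[OF W(1,1,4)] by (simp add: \<tau>_def)
  have \<tau>\<tau>: "\<tau> (\<tau> a) = a" if "a \<in> carrier (L W)" for a
    using hat_comp[OF W(1,1,1,4,4) Mor_id[OF W(1)] _ that] hat_id[OF W(1) that] by (simp add: \<tau>_def)
  \<comment> \<open>Condition (b) extends automorphisms of the subgroup \<open>fam X {u, v}\<close>
    of \<open>L X\<close>, whereas \<tau> acts on \<open>L W\<close>. The automorphism \<beta> is
    \<tau> transported along the inclusion \<open>i\<close>; it is an involution because the swap is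
    one, which makes it bijective.\<close>
  define j where "j = inv_into (carrier (L W)) i"
  have j: "j (i a) = a" if "a \<in> carrier (L W)" for a using that i(2) by (simp add: j_def)
  define \<beta> where "\<beta> = (\<lambda>x\<in>fam X {u, v}. i (\<tau> (j x)))"
  have \<beta>i: "\<beta> (i a) = i (\<tau> a)" if "a \<in> carrier (L W)" for a
    using that i(3) j by (auto simp: \<beta>_def)
  have fam_i: "\<exists>a\<in>carrier (L W). x = i a" if "x \<in> fam X {u, v}" for x using that i(3) by auto
  have i_fam: "i a \<in> fam X {u, v}" if "a \<in> carrier (L W)" for a using that i(3) by auto
  have \<tau>c: "\<tau> a \<in> carrier (L W)" if "a \<in> carrier (L W)" for a using hom_in_carrier[OF \<tau> that] .
  have "\<beta> \<in> auto ?M"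
    unfolding auto_def Bij_def
  proof (intro IntI CollectI)
    show "\<beta> \<in> hom ?M ?M"
    proof (rule homI)
      fix x assume "x \<in> carrier ?M"
      then show "\<beta> x \<in> carrier ?M" using fam_i \<beta>i i_fam \<tau>c by fastforce
    next
      fix x y assume xy: "x \<in> carrier ?M" "y \<in> carrier ?M"
      obtain a b where ab: "a \<in> carrier (L W)" "x = i a" "b \<in> carrier (L W)" "y = i b"
        using fam_i[of x] fam_i[of y] xy by auto
      have c: "a \<otimes>\<^bsub>L W\<^esub> b \<in> carrier (L W)"
        using monoid.m_closed[OF group.is_monoid[OF group_L[OF W(1)]] ab(1,3)] .
      have "\<beta> (i a \<otimes>\<^bsub>L X\<^esub> i b) = \<beta> (i (a \<otimes>\<^bsub>L W\<^esub> b))"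
        using hom_mult[OF i(1) ab(1,3)] by simp
      also have "\<dots> = i (\<tau> a \<otimes>\<^bsub>L W\<^esub> \<tau> b)" using \<beta>i[OF c] hom_mult[OF \<tau> ab(1,3)] by simp
      also have "\<dots> = \<beta> (i a) \<otimes>\<^bsub>L X\<^esub> \<beta> (i b)"
        using hom_mult[OF i(1) \<tau>c[OF ab(1)] \<tau>c[OF ab(3)]] \<beta>i ab by simp
      finally show "\<beta> (x \<otimes>\<^bsub>?M\<^esub> y) = \<beta> x \<otimes>\<^bsub>?M\<^esub> \<beta> y" using ab by simp
    qed
    have inv: "\<forall>x\<in>fam X {u, v}. \<beta> (\<beta> x) = x"
    proof
      fix x assume "x \<in> fam X {u, v}"
      then obtain a where "a \<in> carrier (L W)" "x = i a" using fam_i by auto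
      then show "\<beta> (\<beta> x) = x" using \<beta>i \<tau>c \<tau>\<tau> by simp
    qed
    have "\<beta> ` fam X {u, v} \<subseteq> fam X {u, v}"
      using fam_i \<beta>i i_fam \<tau>c by fastforce
    then show "bij_betw \<beta> (carrier ?M) (carrier ?M)"
      using inv by (intro bij_betw_byWitness[where f' = \<beta>]) auto
  qed (simp add: \<beta>_def)
  then obtain \<beta>' where \<beta>': "\<beta>' \<in> AL_fX (pts X) (L X) (fam X) {u, v}" "\<forall>x\<in>fam X {u, v}. \<beta>' x = \<beta> x"
    using condition_b[OF X] uv unfolding condition_b_def by (metis empty_subsetI finite.emptyI finite.insertI insert_subset)
  have "\<beta>' (label X x0 x d) = label X x0 (transpose u v x) d"
    if xd: "x \<in> pts X" "d \<in> carrier (L ?A)" for x d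
  proof (cases "x \<in> {u, v}")
    case True
    then have t: "transpose u v x \<in> {u, v}" by auto
    \<comment> \<open>The labels at \<open>u\<close> and \<open>v\<close> factor through
      \<open>W\<close>, where \<tau> exchanges them by functoriality.\<close>
    have M: "Mor ?A W (\<lambda>_. x)" "Mor ?A W (\<lambda>_. transpose u v x)"
      "Mor ?A X (\<lambda>_. x)" "Mor ?A X (\<lambda>_. transpose u v x)"
      using Mor_const[OF X W(1) x0] Mor_const[OF X X x0] W(2) True t xd uv by auto
    let ?w = "hat ?A W (\<lambda>_. x) d"
    have w: "?w \<in> carrier (L W)" using hat_closed[OF A(1) W(1) M(1) xd(2)] .
    have "label X x0 x d = i ?w"
      unfolding label_def i_def
      by (rule hat_comp[OF A(1) W(1) X M(1) W(3) M(3) _ xd(2), symmetric]) simp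
    moreover have "\<tau> ?w = hat ?A W (\<lambda>_. transpose u v x) d"
      unfolding \<tau>_def by (rule hat_comp[OF A(1) W(1,1) M(1) W(4) M(2) _ xd(2)]) simp
    moreover have "i (hat ?A W (\<lambda>_. transpose u v x) d) = label X x0 (transpose u v x) d"
      unfolding label_def i_def by (rule hat_comp[OF A(1) W(1) X M(2) W(3) M(4) _ xd(2)]) simp
    ultimately show ?thesis using \<beta>' \<beta>i[OF w] i_fam[OF w] by simp
  next
    case False
    \<comment> \<open>Any other label lies in the subgroup of the complement of
      \<open>{u, v}\<close>, which elements of \<open>AL_fX\<close> fix pointwise.\<close>
    have "label X x0 x d \<in> fam X {x}" using label_image[OF X x0 xd(1)] xd(2) by auto
    also have "\<dots> \<subseteq> fam X (pts X - {u, v})"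
      using fam_generate[OF X, of "pts X - {u, v}"] False xd(1) by (auto intro: generate.incl)
    finally show ?thesis using \<beta>'(1) False by (simp add: AL_fX_def transpose_apply_other)
  qed
  then show ?thesis using \<beta>'(1) by (auto simp: AL_fX_def)
qed

text \<open>The conditional premise on \<open>x0\<close> admits the empty \<open>X\<close>, which
  has no base point and no labels.\<close>

lemma labelled_group_label:
  assumes "Obj X" "\<And>x. x \<in> pts X \<Longrightarrow> x0 \<in> pts X"
  shows "labelled_group (L X) (pts X) (fam X) (carrier (L (ind X {x0}))) (label X x0)"
proof (intro labelled_group.intro labelled_group_axioms.intro)
  show "group (L X)" by (rule group_L[OF assms(1)])
  show "fam X (pts X) = carrier (L X)" using halo[OF assms(1)] by (simp add: halo_def)
  fix Y assume Y: "Y \<subseteq> pts X"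
  have "label X x0 y ` carrier (L (ind X {x0})) = fam X {y}" if "y \<in> Y" for y
    using label_image[OF assms(1) assms(2)] Y that by auto
  then show "fam X Y = generate (L X) (\<Union>y\<in>Y. label X x0 y ` carrier (L (ind X {x0})))"
    using fam_generate[OF assms(1) Y] by simp
qed (rule transposition_in_AL_f[OF assms(1) assms(2)])

text \<open>The functor by itself yields only monomorphisms. Surjectivity comes from the map induced
  by the inverse group element.\<close>

lemma induced_auto:
  assumes X: "Obj X" and \<alpha>: "group_action \<Gamma> (pts X) \<alpha>" "\<And>g. g \<in> carrier \<Gamma> \<Longrightarrow> Mor X X (\<alpha> g)"
    and g: "g \<in> carrier \<Gamma>"
  shows "induced_auto L hat X \<alpha> g \<in> auto (L X)"
proof -
  interpret \<alpha>: group_action \<Gamma> "pts X" \<alpha> by fact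
  have "group \<Gamma>" using \<alpha>.group_hom by (simp add: group_hom_def)
  then have g': "inv\<^bsub>\<Gamma>\<^esub> g \<in> carrier \<Gamma>" using g by simp
  have inverse: "hat X X (\<alpha> h) (hat X X (\<alpha> h') a) = a"
    if "h \<in> carrier \<Gamma>" "h' \<in> carrier \<Gamma>" "h \<otimes>\<^bsub>\<Gamma>\<^esub> h' = \<one>\<^bsub>\<Gamma>\<^esub>" "a \<in> carrier (L X)" for h h' a
  proof -
    have "id x = \<alpha> h (\<alpha> h' x)" if "x \<in> pts X" for x
      using \<alpha>.composition_rule[OF that \<open>h \<in> _\<close> \<open>h' \<in> _\<close>] \<alpha>.id_eq_one that
      by (metis \<open>h \<otimes>\<^bsub>\<Gamma>\<^esub> h' = \<one>\<^bsub>\<Gamma>\<^esub>\<close> id_apply restrict_apply')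
    then show ?thesis
      using hat_comp[OF X X X \<alpha>(2) \<alpha>(2) Mor_id[OF X]] that hat_id[OF X] by simp
  qed
  have "bij_betw (hat X X (\<alpha> g)) (carrier (L X)) (carrier (L X))"
    using inverse[of g "inv\<^bsub>\<Gamma>\<^esub> g"] inverse[of "inv\<^bsub>\<Gamma>\<^esub> g" g] g g' \<open>group \<Gamma>\<close> hat_closed[OF X X \<alpha>(2)]
    by (intro bij_betw_byWitness[where f' = "hat X X (\<alpha> (inv\<^bsub>\<Gamma>\<^esub> g))"]) (auto simp: group.r_inv group.l_inv)
  then have "bij_betw (induced_auto L hat X \<alpha> g) (carrier (L X)) (carrier (L X))"
    by (simp add: induced_auto_def cong: bij_betw_cong)
  moreover have "induced_auto L hat X \<alpha> g \<in> hom (L X) (L X)"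
    by (rule group.hom_restrict[OF group_L[OF X] hat_hom[OF X X \<alpha>(2)[OF g]]])
      (simp add: induced_auto_def)
  ultimately show ?thesis by (simp add: auto_def Bij_def induced_auto_def)
qed

lemma induced_auto_label:
  assumes X: "Obj X" and \<alpha>: "group_action \<Gamma> (pts X) \<alpha>" "Mor X X (\<alpha> g)" and g: "g \<in> carrier \<Gamma>"
    and x: "x0 \<in> pts X" "x \<in> pts X" and d: "d \<in> carrier (L (ind X {x0}))"
  shows "induced_auto L hat X \<alpha> g (label X x0 x d) = label X x0 (\<alpha> g x) d"
proof -
  have "\<alpha> g x \<in> pts X" using group_action.element_image[OF \<alpha>(1) g x(2) refl] .
  then have "hat X X (\<alpha> g) (hat (ind X {x0}) X (\<lambda>_. x) d) = hat (ind X {x0}) X (\<lambda>_. \<alpha> g x) d"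
    using hat_comp[OF Obj_ind[OF X] X X Mor_const[OF X X x] \<alpha>(2) Mor_const[OF X X x(1)] _ d] x by simp
  then show ?thesis using label_closed[OF X x d] by (simp add: induced_auto_def label_def)
qed

theorem LEF_group_enrichment:
  fixes \<Gamma> :: "'a monoid"
  assumes X: "Obj X" and \<Gamma>: "LEF_group \<Gamma>" "LEF_action \<Gamma> (pts X) \<alpha>"
    and Mor: "\<And>g. g \<in> carrier \<Gamma> \<Longrightarrow> Mor X X (\<alpha> g)"
    and AL_f: "LEF_group (AL_f_group (pts X) (L X) (fam X)) \<or>
      (\<forall>Y. Y \<subseteq> pts X \<and> finite Y \<longrightarrow>
        finitely_generated_group (L (ind X Y)) \<and> residually_finite_group (L (ind X Y)))"
  shows "LEF_group (enrichment \<Gamma> (pts X) (L X) (fam X) (induced_auto L hat X \<alpha>))"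
proof -
  \<comment> \<open>If \<open>X\<close> is empty this is an arbitrary element, and the implication
    that follows holds vacuously.\<close>
  define x0 where "x0 = (SOME x. x \<in> pts X)"
  have x0: "x0 \<in> pts X" if "x \<in> pts X" for x
    using that someI[of "\<lambda>x. x \<in> pts X"] by (simp add: x0_def)
  interpret labelled_group "L X" "pts X" "fam X" "carrier (L (ind X {x0}))" "label X x0"
    by (rule labelled_group_label[OF X x0])
  have action: "group_action \<Gamma> (pts X) \<alpha>" using \<Gamma>(2) by (simp add: LEF_action_def)
  have "LEF_group (AL_f_group (pts X) (L X) (fam X))"
    using AL_f
  proof
    assume fg_rf: "\<forall>Y. Y \<subseteq> pts X \<and> finite Y \<longrightarrow>
        finitely_generated_group (L (ind X Y)) \<and> residually_finite_group (L (ind X Y))"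
    show ?thesis
    proof (rule LEF_AL_f_group)
      fix Y assume Y: "finite Y" "Y \<subseteq> pts X"
      let ?W = "ind X Y" and ?M = "L X\<lparr>carrier := fam X Y\<rparr>"
      have W: "Obj ?W" "Mor ?W X id" using Obj_ind[OF X Y(2)] Mor_ind[OF X Y(2)] by auto
      have M: "group ?M" using subgroup_imp_group[OF subgroup_H[OF Y(2)]] .
      \<comment> \<open>The hypotheses concern the groups \<open>L (ind X Y)\<close>, while supports
        live on their images in \<open>L X\<close>. Finite generation moves forward along this
        isomorphism; separation is pulled back along its inverse.\<close>
      have iso: "hat ?W X id \<in> iso (L ?W) ?M"
        using hat_hom[OF W(1) X W(2)] hat_inj[OF W(1) X W(2)]
        by (auto simp: iso_def bij_betw_def hom_def family_def)
      then show "finitely_generated_group ?M"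
        using finitely_generated_group_epi[of "L ?W" ?M] fg_rf Y M
        by (auto simp: iso_def bij_betw_def)
      have "inv_into (carrier (L ?W)) (hat ?W X id) \<in> mon ?M (L ?W)"
        using group.iso_set_sym[OF group_L[OF W(1)] iso] by (auto simp: iso_def mon_def bij_betw_def)
      then show "homs_to_finite_separate ?M"
        using homs_to_finite_separate_mon[OF M group_L[OF W(1)]] fg_rf Y
          homs_to_finite_separate_if_residually_finite by blast
    qed
  qed
  then show ?thesis
    using \<Gamma> induced_auto[OF X action Mor] induced_auto_label[OF X action Mor _ x0]
    by (intro LEF_enrichment) auto
qed

end

section \<open>The two instances: sets and graphs\<close>

lemma set_embedding_comp:
  "set_embedding X Y f \<Longrightarrow> set_embedding Y Z f' \<Longrightarrow> set_embedding X Z (f' \<circ> f)"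
  by (auto simp: set_embedding_def inj_on_def Pi_iff)

lemma halo_functor_set:
  assumes "set_halo L hat" "set_halo_conditions L hat"
  shows "halo_functor (\<lambda>_. True) (\<lambda>X. X) set_embedding (\<lambda>_ Y. Y) L hat"
proof -
  have "family (\<lambda>_ Y. Y) L hat = set_family L hat"
    by (simp add: fun_eq_iff family_def set_family_def)
  with assms show ?thesis
    by unfold_locales
      (simp_all add: set_embedding_comp set_halo_def set_halo_conditions_def,
       auto simp: set_embedding_def)
qed

lemma pair_bidirected_digraph_iff:
  "pair_bidirected_digraph X \<longleftrightarrow> (\<forall>u v. (u, v) \<in> parcs X \<longrightarrow> u \<in> pverts X \<and> v \<in> pverts X \<and>
     (v, u) \<in> parcs X \<and> u \<noteq> v)"
  by (auto simp: pair_bidirected_digraph_def pair_sym_digraph_def pair_sym_digraph_axioms_def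
      pair_loopfree_digraph_def pair_loopfree_digraph_axioms_def pair_wf_digraph_def
      symmetric_def sym_def)

lemma graph_embedding_comp:
  "graph_embedding X Y f \<Longrightarrow> graph_embedding Y Z f' \<Longrightarrow> graph_embedding X Z (f' \<circ> f)"
  by (auto simp: graph_embedding_def inj_on_def Pi_iff)

lemma halo_functor_graph:
  assumes "graph_halo L hat" "graph_halo_conditions L hat"
  shows "halo_functor pair_bidirected_digraph pverts graph_embedding induced L hat"
proof -
  have family: "family induced L hat = graph_family L hat"
    by (simp add: fun_eq_iff family_def graph_family_def)
  show ?thesis
  proof (rule halo_functor.intro)
    fix Z W :: "'a pair_pre_digraph" and u v
    assume Z: "pair_bidirected_digraph Z"
    show "graph_embedding Z Z id" by (auto simp: graph_embedding_def)
    show "halo (pverts Z) (L Z) (family induced L hat Z)"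
      "condition_a (pverts Z) (L Z) (family induced L hat Z)"
      "condition_b (pverts Z) (L Z) (family induced L hat Z)"
      using assms Z by (auto simp: graph_halo_def graph_halo_conditions_def family)
    \<comment> \<open>Symmetry of adjacency makes the swap of two vertices an embedding of the graph
      they induce; absence of loops lets a single vertex be sent to any vertex.\<close>
    have arcs: "(x, y) \<in> parcs Z \<longleftrightarrow> (y, x) \<in> parcs Z" "(x, x) \<notin> parcs Z" for x y
      using Z unfolding pair_bidirected_digraph_iff by blast+
    show "graph_embedding (induced Z {u, v}) (induced Z {u, v}) (transpose u v)"
      using arcs by (auto simp: graph_embedding_def induced_def inj_on_def)
    show "graph_embedding (induced Z {u}) W (\<lambda>_. v)" if "pair_bidirected_digraph W" "v \<in> pverts W"
      using arcs that unfolding pair_bidirected_digraph_iff by (auto simp: graph_embedding_def induced_def)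
  next
    fix Z :: "'a pair_pre_digraph" and Y
    assume ZY: "pair_bidirected_digraph Z" "Y \<subseteq> pverts Z"
    show "graph_embedding (induced Z Y) Z id"
      using ZY by (auto simp: graph_embedding_def induced_def)
    show "pair_bidirected_digraph (induced Z Y)"
      using ZY unfolding pair_bidirected_digraph_iff by (auto simp: induced_def)
  next
    fix Z W W' :: "'a pair_pre_digraph" and f f'
    assume "graph_embedding Z W f" "graph_embedding W W' f'"
    then show "graph_embedding Z W' (f' \<circ> f)" by (rule graph_embedding_comp)
  qed (use assms in \<open>auto simp: graph_halo_def induced_def\<close>)
qed

text \<open>A finitary permutation of the vertices is realised in \<open>AL_f(X)\<close> whether or
  not it respects edges, so the graph case can pass to the underlying action on vertices at this
  point.\<close>

lemma LEF_action_if_LEF_graph_action: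
  assumes "LEF_graph_action \<Gamma> X \<alpha>"
  shows "LEF_action \<Gamma> (pverts X) \<alpha>"
  unfolding LEF_action_def
proof (intro conjI allI impI)
  show "group_action \<Gamma> (pverts X) \<alpha>"
    using assms by (simp add: LEF_graph_action_def graph_action_def)
  fix F Z assume FZ: "finite F \<and> F \<subseteq> carrier \<Gamma> \<and> finite Z \<and> Z \<subseteq> pverts X"
  have "\<forall>F Z. finite F \<and> F \<subseteq> carrier \<Gamma> \<and> finite Z \<and> Z \<subseteq> pverts X \<longrightarrow>
       (\<exists>(Q :: nat monoid) (Y :: nat pair_pre_digraph) \<beta> \<rho> \<pi>.
          group Q \<and> finite (carrier Q) \<and> finite (pverts Y) \<and> graph_action Q Y \<beta> \<and>
          \<rho> \<in> carrier \<Gamma> \<rightarrow> carrier Q \<and> graph_embedding (induced X Z) Y \<pi> \<and>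
          (\<forall>g\<in>F. \<forall>h\<in>F. g \<otimes>\<^bsub>\<Gamma>\<^esub> h \<in> F \<longrightarrow> \<rho> (g \<otimes>\<^bsub>\<Gamma>\<^esub> h) = \<rho> g \<otimes>\<^bsub>Q\<^esub> \<rho> h) \<and>
          (\<forall>g\<in>F. \<forall>x\<in>Z. \<alpha> g x \<in> Z \<longrightarrow> \<pi> (\<alpha> g x) = \<beta> (\<rho> g) (\<pi> x)))"
    using assms by (simp add: LEF_graph_action_def)
  from this[rule_format, OF FZ] obtain Q :: "nat monoid" and Y :: "nat pair_pre_digraph" and \<beta> \<rho> \<pi> where
    "group Q" "finite (carrier Q)" "finite (pverts Y)" "graph_action Q Y \<beta>"
    "\<rho> \<in> carrier \<Gamma> \<rightarrow> carrier Q" "graph_embedding (induced X Z) Y \<pi>"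
    "\<forall>g\<in>F. \<forall>h\<in>F. g \<otimes>\<^bsub>\<Gamma>\<^esub> h \<in> F \<longrightarrow> \<rho> (g \<otimes>\<^bsub>\<Gamma>\<^esub> h) = \<rho> g \<otimes>\<^bsub>Q\<^esub> \<rho> h"
    "\<forall>g\<in>F. \<forall>x\<in>Z. \<alpha> g x \<in> Z \<longrightarrow> \<pi> (\<alpha> g x) = \<beta> (\<rho> g) (\<pi> x)"
    by (elim exE conjE)
  then show "\<exists>(Q :: nat monoid) (Y :: nat set) \<beta> \<rho> \<pi>.
          group Q \<and> finite (carrier Q) \<and> finite Y \<and> group_action Q Y \<beta> \<and>
          \<rho> \<in> carrier \<Gamma> \<rightarrow> carrier Q \<and> set_embedding Z Y \<pi> \<and>
          (\<forall>g\<in>F. \<forall>h\<in>F. g \<otimes>\<^bsub>\<Gamma>\<^esub> h \<in> F \<longrightarrow> \<rho> (g \<otimes>\<^bsub>\<Gamma>\<^esub> h) = \<rho> g \<otimes>\<^bsub>Q\<^esub> \<rho> h) \<and>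
          (\<forall>g\<in>F. \<forall>x\<in>Z. \<alpha> g x \<in> Z \<longrightarrow> \<pi> (\<alpha> g x) = \<beta> (\<rho> g) (\<pi> x))"
    by (intro exI[of _ Q] exI[of _ "pverts Y"] exI[of _ \<beta>] exI[of _ \<rho>] exI[of _ \<pi>])
      (simp add: graph_action_def graph_embedding_def set_embedding_def induced_def)
qed

theorem theorem6p38:
  fixes \<Gamma> :: "'a monoid"
  assumes "LEF_group \<Gamma>"
  shows
    "(\<forall>(X :: 'v set) (L :: 'v set \<Rightarrow> 'g monoid) hat \<alpha>.
        LEF_action \<Gamma> X \<alpha> \<and> set_halo L hat \<and> set_halo_conditions L hat \<longrightarrow>
          (LEF_group (set_AL_f_group L hat X) \<longrightarrow> LEF_group (set_enrichment L hat \<Gamma> X \<alpha>)) \<and>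
          ((\<forall>Y. Y \<subseteq> X \<and> finite Y \<longrightarrow>
              finitely_generated_group (L Y) \<and> residually_finite_group (L Y)) \<longrightarrow>
            LEF_group (set_enrichment L hat \<Gamma> X \<alpha>)))
     \<and>
     (\<forall>(X :: 'w pair_pre_digraph) (L :: 'w pair_pre_digraph \<Rightarrow> 'h monoid) hat \<alpha>.
        LEF_graph_action \<Gamma> X \<alpha> \<and> graph_halo L hat \<and> graph_halo_conditions L hat \<longrightarrow>
          (LEF_group (graph_AL_f_group L hat X) \<longrightarrow>
            LEF_group (graph_enrichment L hat \<Gamma> X \<alpha>)) \<and>
          ((\<forall>Y. Y \<subseteq> pverts X \<and> finite Y \<longrightarrow>
              finitely_generated_group (L (induced X Y)) \<and>
              residually_finite_group (L (induced X Y))) \<longrightarrow>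
            LEF_group (graph_enrichment L hat \<Gamma> X \<alpha>)))"
proof -
  have set: "LEF_group (set_enrichment L hat \<Gamma> X \<alpha>)"
    if "LEF_action \<Gamma> X \<alpha>" "set_halo L hat" "set_halo_conditions L hat"
      and AL_f: "LEF_group (set_AL_f_group L hat X) \<or>
        (\<forall>Y. Y \<subseteq> X \<and> finite Y \<longrightarrow> finitely_generated_group (L Y) \<and> residually_finite_group (L Y))"
    for X :: "'v set" and L :: "'v set \<Rightarrow> 'g monoid" and hat \<alpha>
  proof -
    interpret halo_functor "\<lambda>_. True" "\<lambda>X. X" set_embedding "\<lambda>_ Y. Y" L hat
      by (rule halo_functor_set[OF that(2,3)])
    interpret \<alpha>: group_action \<Gamma> X \<alpha> using that(1) by (simp add: LEF_action_def)
    have fam: "family (\<lambda>_ Y. Y) L hat X = set_family L hat X"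
      by (simp add: fun_eq_iff family_def set_family_def)
    have "set_embedding X X (\<alpha> g)" if "g \<in> carrier \<Gamma>" for g
      using \<alpha>.inj_prop[OF that] \<alpha>.surj_prop[OF that] by (auto simp: set_embedding_def)
    then show ?thesis
      using LEF_group_enrichment[OF TrueI assms that(1)] AL_f
      by (simp add: set_enrichment_def set_AL_f_group_def fam)
  qed
  have graph: "LEF_group (graph_enrichment L hat \<Gamma> X \<alpha>)"
    if "LEF_graph_action \<Gamma> X \<alpha>" "graph_halo L hat" "graph_halo_conditions L hat"
      and AL_f: "LEF_group (graph_AL_f_group L hat X) \<or>
        (\<forall>Y. Y \<subseteq> pverts X \<and> finite Y \<longrightarrow>
          finitely_generated_group (L (induced X Y)) \<and> residually_finite_group (L (induced X Y)))"
    for X :: "'w pair_pre_digraph" and L :: "'w pair_pre_digraph \<Rightarrow> 'h monoid" and hat \<alpha>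
  proof -
    interpret halo_functor pair_bidirected_digraph pverts graph_embedding induced L hat
      by (rule halo_functor_graph[OF that(2,3)])
    have fam: "family induced L hat X = graph_family L hat X"
      by (simp add: fun_eq_iff family_def graph_family_def)
    have X: "pair_bidirected_digraph X" and "\<And>g. g \<in> carrier \<Gamma> \<Longrightarrow> graph_embedding X X (\<alpha> g)"
      using that(1) by (auto simp: LEF_graph_action_def graph_action_def)
    then show ?thesis
      using LEF_group_enrichment[OF X assms LEF_action_if_LEF_graph_action[OF that(1)]] AL_f
      by (simp add: graph_enrichment_def graph_AL_f_group_def fam)
  qed
  show ?thesis
    by (intro conjI allI impI; elim conjE) (rule set graph; simp)+
qed

end
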